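(* Let $\mathcal{K}$ be a collection of compact convex sets in $\mathbb{R}^n$ that is stable under sums and dilation. Then the following statements are equivalent: 1. For every $m\ge 1$ and every $A,B_1,\dots,B_m\in\mathcal{K}$, $$|A|^{m-1}\Big|A+\sum_{i=1}^m B_i\Big|\le\prod_{i=1}^m|A+B_i|.$$ 2. For every $m\ge1$ and every $A,B_1,\dots,B_m\in\mathcal{K}$, the set function $\bar w:2^{[m]}\to[-\infty,\infty)$ defined by $\bar w(S)=\log\big|A+\sum_{i\in S}B_i\big|$ for each $S\in 2^{[m]}$ is submodular. 3. For every $m\ge1$ (and every $A,B_1,\dots,B_m\in\mathcal{K}$) and any multi-hypergraphs $\mathcal{A},\mathcal{B}$ on $[m]$ with $\mathcal{A}>\mathcal{B}$, $$\sum_{S\in\mathcal{A}}\bar w(S)\ge\sum_{T\in\mathcal{B}}\bar w(T),$$ where $\bar w(S)=\log\big|A+\sum_{i\in S}B_i\big|$. 4. For every $m\ge1$ and every $A,B_1,\dots,B_m\in\mathcal{K}$, the function $w:\mathbb{R}_+^m\to[-\infty,\infty)$ defined by $w(x)=\log\big|A+\sum_{i=1}^m x_iB_i\big|$ for $x=(x_1,\dots,x_m)\in\mathbb{R}_+^m$ is submodular. 5. For every $A,B_1,B_2\in\mathcal{K}$, $$|A|\,V(A[n-2],B_1,B_2)\le\frac{n}{n-1}V(A[n-1],B_1)\,V(A[n-1],B_2).$$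
   Context: $|\cdot|$ denotes $n$-dimensional volume (Lebesgue measure) in $\mathbb{R}^n$, $+$ is Minkowski sum, $V(K_1,\dots,K_n)$ is the mixed volume of compact convex sets, normalized so that $V(K,\dots,K)=|K|$, and $K[j]$ means that $K$ is repeated $j$ times. "Stable under sums and dilation" means that $A+B\in\mathcal{K}$ and $tA\in\mathcal{K}$ whenever $A,B\in\mathcal{K}$ and $t>0$. $[m]=\{1,\dots,m\}$, $2^{[m]}$ is the family of subsets of $[m]$, $\mathbb{R}_+=[0,\infty)$, $\log 0=-\infty$. A set function $F$ on $2^{[m]}$ is submodular if $F(S\cup T)+F(S\cap T)\le F(S)+F(T)$ for all $S,T\subset[m]$. A function $f$ on $\mathbb{R}_+^m$ is submodular if $f(x\vee y)+f(x\wedge y)\le f(x)+f(y)$ for all $x,y\in\mathbb{R}_+^m$, where $x\vee y$ and $x\wedge y$ are the componentwise maximum and minimum. A multi-hypergraph on $[m]$ is a finite family of non-empty subsets of $[m]$, with repetitions allowed. Given a multi-hypergraph $\mathcal{C}=\{S_1,\dots,S_l\}$ and a pair of non-nested sets $S_i,S_j$ in $\mathcal{C}$, the elementary compression of $\mathcal{C}$ is the multi-hypergraph obtained by replacing $S_i$ and $S_j$ by $S_i\cap S_j$ and $S_i\cup S_j$, keeping only $S_i\cup S_j$ if $S_i\cap S_j=\emptyset$. The result of a sequence of elementary compressions is called a compression, and $\mathcal{A}>\mathcal{B}$ means that $\mathcal{B}$ is a compression of $\mathcal{A}$.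
   Formalization: Statement 3 is corrected: each empty set discarded by a compression is counted on the right, adding (#A − #B)·log|A|; as written it fails, e.g. for small dilates of a cube. Also n ≥ 2 is assumed (statement 5 is undefined for n = 1) and the sets are nonempty. *)

theory Defs
  imports "HOL-Analysis.Analysis" "HOL-Library.Multiset"
begin

text \<open>
  Minkowski sums are the pointwise \<open>+\<close> and \<open>\<Sum>\<close> on sets from \<^theory>\<open>HOL-Library.Set_Algebras\<close>;
  in particular the empty Minkowski sum is \<open>{0}\<close>.
\<close>

abbreviation vol :: "(real ^ 'n) set \<Rightarrow> real" where
  "vol K \<equiv> measure lebesgue K"

definition dilate :: "real \<Rightarrow> 'a::real_vector set \<Rightarrow> 'a set" where
  "dilate t K = (\<lambda>x. t *\<^sub>R x) ` K"

definition stable_under_sums_and_dilation :: "'a::real_vector set set \<Rightarrow> bool" where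
  "stable_under_sums_and_dilation \<K> \<longleftrightarrow>
     (\<forall>A\<in>\<K>. \<forall>B\<in>\<K>. A + B \<in> \<K>) \<and> (\<forall>A\<in>\<K>. \<forall>t>0. dilate t A \<in> \<K>)"

text \<open>The logarithm of a volume, with \<open>log 0 = -\<infinity>\<close>; it is only applied to \<open>v \<ge> 0\<close>.\<close>

definition log_ext :: "real \<Rightarrow> ereal" where
  "log_ext v = (if v = 0 then -\<infinity> else ereal (ln v))"


definition convex_bodies :: "'a::euclidean_space set set" where
  "convex_bodies = {K. K \<noteq> {} \<and> compact K \<and> convex K}"

text \<open>
  Mixed volumes are the symmetric coefficients in Minkowski's theorem
  \[ |t_1 K_1 + \cdots + t_m K_m| =
     \sum_{i_1,\ldots,i_n = 1}^m V(K_{i_1},\ldots,K_{i_n})\, t_{i_1} \cdots t_{i_n}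
     \qquad (t_1,\ldots,t_m \ge 0). \]
  The case \<open>m = 1\<close>, \<open>t\<^sub>1 = 1\<close> is the normalization \<open>V(K,\<dots>,K) = |K|\<close>. An \<open>n\<close>-tuple of bodies is a
  list of length \<open>n = CARD('n)\<close>. The two conditions determine \<open>V\<close> on such lists of convex bodies;
  on all other lists the values of \<open>mixed_volume\<close> are unspecified.
\<close>

definition is_mixed_volume :: "((real ^ 'n) set list \<Rightarrow> real) \<Rightarrow> bool" where
  "is_mixed_volume V \<longleftrightarrow>
     (\<forall>Ks Ls. length Ks = CARD('n) \<and> set Ks \<subseteq> convex_bodies \<and> mset Ls = mset Ks \<longrightarrow> V Ls = V Ks) \<and>
     (\<forall>(m::nat) K t. (\<forall>i\<in>{1..m}. K i \<in> convex_bodies \<and> t i \<ge> 0) \<longrightarrow>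
        vol (\<Sum>i\<in>{1..m}. dilate (t i) (K i)) =
        (\<Sum>is\<in>{is. set is \<subseteq> {1..m} \<and> length is = CARD('n)}. V (map K is) * prod_list (map t is)))"

definition mixed_volume :: "(real ^ 'n) set list \<Rightarrow> real" where
  "mixed_volume = (SOME V. is_mixed_volume V)"


definition submodular_set_fun :: "nat \<Rightarrow> (nat set \<Rightarrow> ereal) \<Rightarrow> bool" where
  "submodular_set_fun m F \<longleftrightarrow>
     (\<forall>S T. S \<subseteq> {1..m} \<and> T \<subseteq> {1..m} \<longrightarrow> F (S \<union> T) + F (S \<inter> T) \<le> F S + F T)"

definition orthant :: "nat \<Rightarrow> (nat \<Rightarrow> real) set" where
  "orthant m = {1..m} \<rightarrow>\<^sub>E {0..}"

text \<open>The maximum and minimum below are again in \<open>orthant m\<close>: off \<open>{1..m}\<close>, \<open>x\<close> and \<open>y\<close> are both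
  \<open>undefined\<close>, and so are their maximum and minimum.\<close>

definition submodular_fun :: "nat \<Rightarrow> ((nat \<Rightarrow> real) \<Rightarrow> ereal) \<Rightarrow> bool" where
  "submodular_fun m f \<longleftrightarrow>
     (\<forall>x\<in>orthant m. \<forall>y\<in>orthant m.
        f (\<lambda>i. max (x i) (y i)) + f (\<lambda>i. min (x i) (y i)) \<le> f x + f y)"


definition multi_hypergraph :: "nat \<Rightarrow> nat set multiset \<Rightarrow> bool" where
  "multi_hypergraph m \<C> \<longleftrightarrow> (\<forall>S\<in>#\<C>. S \<noteq> {} \<and> S \<subseteq> {1..m})"

definition elementary_compression :: "nat set multiset \<Rightarrow> nat set multiset \<Rightarrow> bool" where
  "elementary_compression \<C> \<D> \<longleftrightarrow>
     (\<exists>S T. {#S, T#} \<subseteq># \<C> \<and> \<not> S \<subseteq> T \<and> \<not> T \<subseteq> S \<and>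
        \<D> = \<C> - {#S, T#} + (if S \<inter> T = {} then {#S \<union> T#} else {#S \<inter> T, S \<union> T#}))"

text \<open>\<open>compresses_to \<A> \<B>\<close> is the relation \<open>\<A> > \<B>\<close>; the empty sequence of compressions is included.\<close>

definition compresses_to :: "nat set multiset \<Rightarrow> nat set multiset \<Rightarrow> bool" where
  "compresses_to = elementary_compression\<^sup>*\<^sup>*"

text \<open>
  An elementary compression of disjoint sets discards their empty intersection and lowers the
  number of sets by one; otherwise that number is unchanged. Hence a compression from \<open>\<A>\<close> to \<open>\<B>\<close>
  discards exactly \<open>size \<A> - size \<B>\<close> empty sets. For a set function \<open>F\<close> with \<open>F {} = 0\<close> these can be
  ignored in a sum of \<open>F\<close> over the family, but \<open>S \<mapsto> log |A + \<Sum>\<^bsub>i\<in>S\<^esub> B\<^sub>i|\<close> has the value \<open>log |A|\<close> at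
  the empty set. The family \<open>restore_discarded \<A> \<B>\<close> puts them back. Without them, the inequality
  between the sums over \<open>\<A>\<close> and \<open>\<B>\<close> would fail for every class of bodies that is closed under
  sums and dilations and contains a body of positive volume: sets \<open>{1}\<close>, \<open>{2}\<close> compressing to \<open>{1, 2}\<close>
  and \<open>A = B\<^sub>1 = B\<^sub>2 = t K\<close> would give \<open>(2t)\<^bsup>2n\<^esup> |K|\<^sup>2 \<ge> (3t)\<^sup>n |K|\<close>, which is false for small \<open>t\<close>.
\<close>

definition restore_discarded :: "nat set multiset \<Rightarrow> nat set multiset \<Rightarrow> nat set multiset" where
  "restore_discarded \<A> \<B> = \<B> + replicate_mset (size \<A> - size \<B>) {}"

end

theory Submission
  imports Defs "HOL-Combinatorics.Multiset_Permutations"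
begin

text \<open>
  Statements 1 to 4 are all equivalent to \<open>|A| |A + B + C| \<le> |A + B| |A + C|\<close> for \<open>A, B, C \<in> \<K>\<close>:
  convexity and stability allow one to absorb the common part of two sums into \<open>A\<close>. By Minkowski's theorem,
  \<open>p(s, t) = |A + sB + tC|\<close> is a polynomial whose coefficients of \<open>s\<close>, \<open>t\<close>, \<open>st\<close> are
  \<open>n V(A[n-1], B)\<close>, \<open>n V(A[n-1], C)\<close>, \<open>n(n-1) V(A[n-2], B, C)\<close>. Comparing the coefficients of \<open>st\<close> in
  \<open>p(0, 0) p(s, t) \<le> p(s, 0) p(0, t)\<close> gives statement 5. Conversely, statement 5 for \<open>A + sB + tC\<close>
  in place of \<open>A\<close> says that \<open>log p\<close> has a nonpositive mixed derivative at \<open>(s, t)\<close>; integrate.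

  Minkowski's theorem is obtained by a change of variables (an idea of Gromov). For the convex hull of a finite
  set \<open>F\<close> with nonempty interior, the gradient of \<open>x \<mapsto> log (\<Sum>v\<in>F. exp (x \<bullet> v))\<close> has its values in the hull,
  and its derivative \<open>H\<^sub>F(x)\<close> is positive definite. The map \<open>\<Sum>i. t\<^sub>i \<nabla>f\<^sub>i\<close> is injective and its image is
  \<open>\<Sum>i. t\<^sub>i (hull F\<^sub>i)\<close> up to boundary points, whence
  \<open>|\<Sum>i. t\<^sub>i (hull F\<^sub>i)| = \<integral> det (\<Sum>i. t\<^sub>i H\<^sub>i(x)) dx\<close>. The integrand is a homogeneous
  polynomial in \<open>t\<close> of degree \<open>n\<close> and therefore equals the form given by polarization. This is a linear
  identity, so it survives integration, and also the limit from polytopes to compact convex sets.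
\<close>

section \<open>Exponentially tilted means\<close>

definition partition_sum :: "'a::euclidean_space set \<Rightarrow> 'a \<Rightarrow> real" where
  "partition_sum F x = (\<Sum>v\<in>F. exp (x \<bullet> v))"

text \<open>The mean of the Gibbs measure on \<open>F\<close> with weights
  \<open>exp (x \<bullet> v)\<close>, which is the gradient of the log-partition function.\<close>

definition tilted_mean :: "'a::euclidean_space set \<Rightarrow> 'a \<Rightarrow> 'a" where
  "tilted_mean F x = (\<Sum>v\<in>F. exp (x \<bullet> v) *\<^sub>R v) /\<^sub>R partition_sum F x"

text \<open>The covariance operator of the same measure, applied to \<open>h\<close>: the Hessian of
  the log-partition function. Only one factor is centered; centering the other would not change the
  value, because the weighted sum of \<open>(v - tilted_mean F x) \<bullet> h\<close> is
  zero.\<close>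

definition tilted_cov :: "'a::euclidean_space set \<Rightarrow> 'a \<Rightarrow> 'a \<Rightarrow> 'a" where
  "tilted_cov F x h = (\<Sum>v\<in>F. (exp (x \<bullet> v) * ((v - tilted_mean F x) \<bullet> h)) *\<^sub>R v) /\<^sub>R partition_sum F x"

lemma partition_sum_pos:
  assumes "finite F" "F \<noteq> {}"
  shows "partition_sum F x > 0"
  unfolding partition_sum_def using assms by (intro sum_pos) auto

lemma sum_exp_eq_tilted_mean:
  assumes "finite F" "F \<noteq> {}"
  shows "(\<Sum>v\<in>F. exp (x \<bullet> v) *\<^sub>R v) = partition_sum F x *\<^sub>R tilted_mean F x"
  using partition_sum_pos[OF assms, of x] by (simp add: tilted_mean_def)

lemma has_derivative_partition_sum:
  assumes "finite F" "F \<noteq> {}"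
  shows "(partition_sum F has_derivative (\<lambda>h. partition_sum F x * (tilted_mean F x \<bullet> h))) (at x)"
proof -
  have "(partition_sum F has_derivative (\<lambda>h. \<Sum>v\<in>F. exp (x \<bullet> v) * (h \<bullet> v))) (at x)"
    unfolding partition_sum_def by (auto intro!: derivative_eq_intros simp: mult.commute)
  moreover have "(\<Sum>v\<in>F. exp (x \<bullet> v) * (h \<bullet> v)) = partition_sum F x * (tilted_mean F x \<bullet> h)" for h
    using arg_cong[OF sum_exp_eq_tilted_mean[OF assms, of x], of "\<lambda>y. y \<bullet> h"]
    by (simp add: inner_sum_right inner_commute[of _ h])
  ultimately show ?thesis by simp
qed

lemma has_derivative_ln_partition_sum:
  assumes "finite F" "F \<noteq> {}"
  shows "((\<lambda>x. ln (partition_sum F x)) has_derivative (\<lambda>h. tilted_mean F x \<bullet> h)) (at x)"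
  using partition_sum_pos[OF assms, of x]
  by (auto intro!: derivative_eq_intros has_derivative_partition_sum assms)

lemma has_derivative_tilted_mean:
  assumes "finite F" "F \<noteq> {}"
  shows "(tilted_mean F has_derivative tilted_cov F x) (at x)"
proof -
  define Z m where "Z = partition_sum F x" and "m = tilted_mean F x"
  have Z: "Z > 0" unfolding Z_def by (rule partition_sum_pos[OF assms])
  define N' where "N' h = (\<Sum>v\<in>F. (exp (x \<bullet> v) * (h \<bullet> v)) *\<^sub>R v)" for h
  have N: "((\<lambda>x. \<Sum>v\<in>F. exp (x \<bullet> v) *\<^sub>R v) has_derivative N') (at x)"
    unfolding N'_def by (auto intro!: derivative_eq_intros simp: mult.commute)
  have *: "((\<lambda>x. inverse (partition_sum F x) *\<^sub>R (\<Sum>v\<in>F. exp (x \<bullet> v) *\<^sub>R v)) has_derivative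
      (\<lambda>h. inverse Z *\<^sub>R N' h + (- (inverse Z * (Z * (m \<bullet> h)) * inverse Z)) *\<^sub>R (Z *\<^sub>R m))) (at x)"
    using has_derivative_scaleR[OF Deriv.has_derivative_inverse[OF _ has_derivative_partition_sum[OF assms]] N]
      Z unfolding sum_exp_eq_tilted_mean[OF assms, of x] by (simp add: Z_def m_def)
  \<comment> \<open>The last term of the quotient rule, written back as a weighted sum over
    \<open>F\<close>, is what centers \<open>v\<close> in \<open>tilted_cov\<close>.\<close>
  have "tilted_cov F x h = inverse Z *\<^sub>R N' h + (- (inverse Z * (Z * (m \<bullet> h)) * inverse Z)) *\<^sub>R (Z *\<^sub>R m)" for h
  proof -
    have "tilted_cov F x h = inverse Z *\<^sub>R (N' h - (m \<bullet> h) *\<^sub>R (\<Sum>v\<in>F. exp (x \<bullet> v) *\<^sub>R v))"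
      unfolding tilted_cov_def N'_def Z_def[symmetric] m_def[symmetric] scaleR_right.sum
        sum_subtractf[symmetric]
      by (intro arg_cong[where f="\<lambda>y. _ *\<^sub>R y"] sum.cong)
        (auto simp: algebra_simps inner_diff_left inner_commute)
    also have "\<dots> = inverse Z *\<^sub>R N' h - (m \<bullet> h) *\<^sub>R m"
      using Z unfolding sum_exp_eq_tilted_mean[OF assms, of x] by (simp add: Z_def m_def algebra_simps)
    finally show ?thesis using Z by simp
  qed
  then have "tilted_cov F x = (\<lambda>h. inverse Z *\<^sub>R N' h + (- (inverse Z * (Z * (m \<bullet> h)) * inverse Z)) *\<^sub>R (Z *\<^sub>R m))"
    by blast
  then show ?thesis using * by (simp add: tilted_mean_def[abs_def])
qed

lemma tilted_mean_in_hull: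
  assumes "finite F" "F \<noteq> {}"
  shows "tilted_mean F x \<in> convex hull F"
proof -
  have Z: "partition_sum F x > 0" by (rule partition_sum_pos[OF assms])
  have "(\<Sum>v\<in>F. (exp (x \<bullet> v) / partition_sum F x) *\<^sub>R v) \<in> convex hull F"
    using Z assms(1) by (intro convex_sum) (auto simp: hull_inc partition_sum_def simp flip: sum_divide_distrib)
  moreover have "(\<Sum>v\<in>F. (exp (x \<bullet> v) / partition_sum F x) *\<^sub>R v) = tilted_mean F x"
    by (simp add: tilted_mean_def scaleR_sum_right divide_inverse_commute)
  ultimately show ?thesis by simp
qed

text \<open>The quadratic form is the variance of \<open>v \<bullet> h\<close>: the centered first
  moment vanishes, so the uncentered factor may be centered.\<close>

lemma inner_tilted_cov:
  assumes "finite F" "F \<noteq> {}"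
  shows "h \<bullet> tilted_cov F x h = (\<Sum>v\<in>F. exp (x \<bullet> v) * ((v - tilted_mean F x) \<bullet> h)\<^sup>2) / partition_sum F x"
proof -
  let ?m = "tilted_mean F x"
  have "(\<Sum>v\<in>F. exp (x \<bullet> v) * ((v - ?m) \<bullet> h)) = ((\<Sum>v\<in>F. exp (x \<bullet> v) *\<^sub>R v) - partition_sum F x *\<^sub>R ?m) \<bullet> h"
    by (simp add: inner_sum_left inner_diff_left partition_sum_def sum_distrib_right right_diff_distrib sum_subtractf)
  then have z: "(\<Sum>v\<in>F. exp (x \<bullet> v) * ((v - ?m) \<bullet> h)) = 0"
    by (simp add: sum_exp_eq_tilted_mean[OF assms])
  have "(\<Sum>v\<in>F. exp (x \<bullet> v) * ((v - ?m) \<bullet> h)\<^sup>2) =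
      (\<Sum>v\<in>F. exp (x \<bullet> v) * ((v - ?m) \<bullet> h) * (v \<bullet> h)) - (\<Sum>v\<in>F. exp (x \<bullet> v) * ((v - ?m) \<bullet> h)) * (?m \<bullet> h)"
    unfolding sum_distrib_right sum_subtractf[symmetric]
    by (intro sum.cong) (auto simp: power2_eq_square inner_diff_left algebra_simps)
  also have "\<dots> = (\<Sum>v\<in>F. exp (x \<bullet> v) * ((v - ?m) \<bullet> h) * (v \<bullet> h))" using z by simp
  finally show ?thesis
    by (simp add: tilted_cov_def inner_sum_right inner_commute[of h] divide_inverse_commute)
qed

text \<open>Zero variance would put \<open>F\<close>, hence its hull, into a hyperplane orthogonal
  to \<open>h\<close>, which has empty interior.\<close>

lemma tilted_cov_pos_def:
  assumes F: "finite F" "interior (convex hull F) \<noteq> {}" and h: "h \<noteq> 0"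
  shows "h \<bullet> tilted_cov F x h > 0"
proof -
  have ne: "F \<noteq> {}" using F by auto
  let ?m = "tilted_mean F x"
  have "\<exists>v\<in>F. (v - ?m) \<bullet> h \<noteq> 0"
  proof (rule ccontr)
    assume "\<not> ?thesis"
    then have "F \<subseteq> {y. h \<bullet> y = h \<bullet> ?m}" by (auto simp: inner_diff_left inner_commute[of h])
    then have "convex hull F \<subseteq> {y. h \<bullet> y = h \<bullet> ?m}" by (intro hull_minimal convex_hyperplane)
    then have "interior (convex hull F) \<subseteq> interior {y. h \<bullet> y = h \<bullet> ?m}" by (rule interior_mono)
    then show False using F h interior_hyperplane[OF h] by auto
  qed
  then obtain v where "v \<in> F" "(v - ?m) \<bullet> h \<noteq> 0" by blast
  then have "(\<Sum>v\<in>F. exp (x \<bullet> v) * ((v - ?m) \<bullet> h)\<^sup>2) > 0"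
    using F by (intro sum_pos2[of _ v]) auto
  then show ?thesis using partition_sum_pos[OF F(1) ne, of x] by (simp add: inner_tilted_cov F(1) ne)
qed

section \<open>Volumes of sums of polytopes as integrals of determinants\<close>

lemma compact_set_plus:
  fixes S T :: "'a::real_normed_vector set"
  assumes "compact S" "compact T"
  shows "compact (S + T)"
proof -
  have "S + T = (\<Union>x\<in>S. \<Union>y\<in>T. {x + y})" by (auto simp: set_plus_def)
  then show ?thesis using compact_sums'[OF assms] by simp
qed

lemma compact_set_sum:
  fixes B :: "'i \<Rightarrow> 'a::real_normed_vector set"
  assumes "\<And>i. i \<in> I \<Longrightarrow> compact (B i)"
  shows "compact (\<Sum>i\<in>I. B i)"
  using assms by (induction I rule: infinite_finite_induct) (auto simp: compact_set_plus)

lemma compact_dilate: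
  fixes K :: "'a::real_normed_vector set"
  assumes "compact K" shows "compact (dilate t K)"
  unfolding dilate_def by (rule compact_scaling[OF assms])

lemma convex_dilate: "convex K \<Longrightarrow> convex (dilate t K)"
  unfolding dilate_def by (rule convex_scaling)

lemma dilate_0 [simp]: "K \<noteq> {} \<Longrightarrow> dilate 0 K = {0}"
  by (auto simp: dilate_def)

lemma mem_sum_dilate_iff:
  assumes I: "finite I"
  shows "w \<in> (\<Sum>i\<in>I. dilate (t i) (K i)) \<longleftrightarrow> (\<exists>k. (\<forall>i\<in>I. k i \<in> K i) \<and> w = (\<Sum>i\<in>I. t i *\<^sub>R k i))"
proof
  assume "w \<in> (\<Sum>i\<in>I. dilate (t i) (K i))"
  then obtain s where s: "w = sum s I" "\<forall>i\<in>I. \<exists>k. k \<in> K i \<and> s i = t i *\<^sub>R k"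
    unfolding set_sum_alt[OF I] dilate_def image_iff by blast
  then obtain k where k: "\<forall>i\<in>I. k i \<in> K i \<and> s i = t i *\<^sub>R k i" by metis
  then have "sum s I = (\<Sum>i\<in>I. t i *\<^sub>R k i)" by (intro sum.cong) auto
  then show "\<exists>k. (\<forall>i\<in>I. k i \<in> K i) \<and> w = (\<Sum>i\<in>I. t i *\<^sub>R k i)" using s k by auto
next
  assume "\<exists>k. (\<forall>i\<in>I. k i \<in> K i) \<and> w = (\<Sum>i\<in>I. t i *\<^sub>R k i)"
  then show "w \<in> (\<Sum>i\<in>I. dilate (t i) (K i))"
    unfolding set_sum_alt[OF I] dilate_def by blast
qed

text \<open>The determinant has no zero on the segment from the identity to the matrix.\<close>

lemma det_pos_of_positive_definite:
  fixes A :: "real^'n^'n"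
  assumes pd: "\<And>h. h \<noteq> 0 \<Longrightarrow> h \<bullet> (A *v h) > 0"
  shows "det A > 0"
proof (rule ccontr)
  assume "\<not> det A > 0"
  define f where "f s = det ((1 - s) *\<^sub>R mat 1 + s *\<^sub>R A)" for s
  have "continuous_on {0..1} f"
    unfolding f_def det_def by (intro continuous_intros)
  moreover have "f 0 = 1" "f 1 \<le> 0" using \<open>\<not> det A > 0\<close> by (auto simp: f_def)
  ultimately obtain s where s: "0 \<le> s" "s \<le> 1" "f s = 0"
    using IVT2'[of f 1 0 0] by auto
  then have "\<not> invertible ((1 - s) *\<^sub>R mat 1 + s *\<^sub>R A)"
    unfolding f_def by (simp add: invertible_det_nz)
  then obtain h where h: "h \<noteq> 0" "((1 - s) *\<^sub>R mat 1 + s *\<^sub>R A) *v h = 0"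
    by (auto simp: invertible_left_inverse matrix_left_invertible_ker)
  then have "0 = h \<bullet> (((1 - s) *\<^sub>R mat 1 + s *\<^sub>R A) *v h)" by simp
  also have "\<dots> = (1 - s) * (h \<bullet> h) + s * (h \<bullet> (A *v h))"
    by (simp add: matrix_vector_mult_add_rdistrib scaleR_matrix_vector_assoc[symmetric] inner_add_right)
  also have "\<dots> > 0"
  proof (cases "s = 0")
    case False
    then have "s * (h \<bullet> (A *v h)) > 0" using s pd[OF h(1)] by simp
    moreover have "(1 - s) * (h \<bullet> h) \<ge> 0" using s by simp
    ultimately show ?thesis by linarith
  qed (use h in simp)
  finally show False by simp
qed

section \<open>The gradient map of a weighted sum of log-partition functions\<close>

context
  fixes F :: "'i \<Rightarrow> 'a::euclidean_space set" and I :: "'i set" and t :: "'i \<Rightarrow> real"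
  assumes I: "finite I" "I \<noteq> {}" and t: "\<And>i. i \<in> I \<Longrightarrow> t i > 0"
    and F: "\<And>i. i \<in> I \<Longrightarrow> finite (F i)" "\<And>i. i \<in> I \<Longrightarrow> interior (convex hull (F i)) \<noteq> {}"
begin

lemma F_nonempty: "i \<in> I \<Longrightarrow> F i \<noteq> {}"
  using F by fastforce

definition gradient_map where
  "gradient_map x = (\<Sum>i\<in>I. t i *\<^sub>R tilted_mean (F i) x)"

lemma has_derivative_gradient_map:
  "(gradient_map has_derivative (\<lambda>h. \<Sum>i\<in>I. t i *\<^sub>R tilted_cov (F i) x h)) (at x)"
  unfolding gradient_map_def
  by (intro has_derivative_sum has_derivative_scaleR_right has_derivative_tilted_mean F F_nonempty)

lemma inner_derivative_gradient_map_pos: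
  assumes "h \<noteq> 0"
  shows "h \<bullet> (\<Sum>i\<in>I. t i *\<^sub>R tilted_cov (F i) x h) > 0"
  unfolding inner_sum_right inner_scaleR_right
  using I t by (intro sum_pos mult_pos_pos tilted_cov_pos_def F assms)

text \<open>Strict monotonicity of the gradient of a strictly convex function: its component along
  \<open>x - y\<close> strictly increases on the segment from \<open>y\<close> to
  \<open>x\<close>.\<close>

lemma inj_gradient_map: "inj gradient_map"
proof (rule injI, rule ccontr)
  fix x y assume eq: "gradient_map x = gradient_map y" and "x \<noteq> y"
  define h where "h = x - y"
  have h: "h \<noteq> 0" using \<open>x \<noteq> y\<close> by (simp add: h_def)
  define \<phi> where "\<phi> s = h \<bullet> gradient_map (y + s *\<^sub>R h)" for s
  have "(\<phi> has_derivative (\<lambda>s'. h \<bullet> (\<Sum>i\<in>I. t i *\<^sub>R tilted_cov (F i) (y + s *\<^sub>R h) (s' *\<^sub>R h)))) (at s)" for s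
    unfolding \<phi>_def
    by (rule has_derivative_inner_right, rule has_derivative_compose[OF _ has_derivative_gradient_map])
      (auto intro!: derivative_eq_intros)
  moreover have "h \<bullet> (\<Sum>i\<in>I. t i *\<^sub>R tilted_cov (F i) (y + s *\<^sub>R h) (s' *\<^sub>R h))
      = (h \<bullet> (\<Sum>i\<in>I. t i *\<^sub>R tilted_cov (F i) (y + s *\<^sub>R h) h)) * s'" for s s'
    using linear_scale[OF has_derivative_linear[OF has_derivative_gradient_map], of "y + s *\<^sub>R h" s' h]
    by simp
  ultimately have "(\<phi> has_real_derivative (h \<bullet> (\<Sum>i\<in>I. t i *\<^sub>R tilted_cov (F i) (y + s *\<^sub>R h) h))) (at s)" for s
    unfolding has_field_derivative_def by (simp add: mult_commute_abs)
  then have d: "\<exists>d. (\<phi> has_real_derivative d) (at s) \<and> d > 0" for s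
    using inner_derivative_gradient_map_pos[OF h] by blast
  have lt: "\<phi> 0 < \<phi> 1"
    by (rule DERIV_pos_imp_increasing[OF zero_less_one]) (rule d)
  have "\<phi> 0 = \<phi> 1" unfolding \<phi>_def using eq by (simp add: h_def)
  with lt show False by simp
qed

lemma gradient_map_in_sum: "gradient_map x \<in> (\<Sum>i\<in>I. dilate (t i) (convex hull (F i)))"
  unfolding mem_sum_dilate_iff[OF I(1)] gradient_map_def
  by (intro exI[of _ "\<lambda>i. tilted_mean (F i) x"] conjI ballI refl tilted_mean_in_hull F F_nonempty)

text \<open>A single exponential is at most the whole partition sum, so the log-partition function
  dominates the support function of the hull. This yields coercivity below.\<close>

lemma inner_le_ln_partition_sum:
  assumes "w \<in> (\<Sum>i\<in>I. dilate (t i) (convex hull (F i)))"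
  shows "x \<bullet> w \<le> (\<Sum>i\<in>I. t i * ln (partition_sum (F i) x))"
proof -
  have hull: "x \<bullet> v \<le> ln (partition_sum (F i) x)" if "i \<in> I" "v \<in> convex hull (F i)" for i v
  proof -
    have "x \<bullet> u \<le> ln (partition_sum (F i) x)" if "u \<in> F i" for u
    proof -
      have "exp (x \<bullet> u) \<le> partition_sum (F i) x"
        unfolding partition_sum_def using that F(1)[OF \<open>i \<in> I\<close>] by (intro member_le_sum) auto
      then show ?thesis
        using partition_sum_pos[OF F(1) F_nonempty, OF \<open>i \<in> I\<close> \<open>i \<in> I\<close>] by (simp add: ln_ge_iff)
    qed
    then have "convex hull (F i) \<subseteq> {u. x \<bullet> u \<le> ln (partition_sum (F i) x)}"
      by (intro hull_minimal convex_halfspace_le) auto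
    then show ?thesis using that by auto
  qed
  obtain v where v: "\<forall>i\<in>I. v i \<in> convex hull (F i)" "w = (\<Sum>i\<in>I. t i *\<^sub>R v i)"
    using assms unfolding mem_sum_dilate_iff[OF I(1)] by blast
  then show ?thesis
    unfolding v(2) inner_sum_right inner_scaleR_right
    using hull t by (intro sum_mono mult_left_mono) (auto simp: less_imp_le)
qed

text \<open>A point \<open>z\<close> of the interior is attained at the minimum of the coercive function \<open>\<Phi>\<close> below, whose
  gradient is \<open>gradient_map - z\<close>.\<close>

lemma interior_subset_range_gradient_map:
  "interior (\<Sum>i\<in>I. dilate (t i) (convex hull (F i))) \<subseteq> range gradient_map"
proof
  fix z assume "z \<in> interior (\<Sum>i\<in>I. dilate (t i) (convex hull (F i)))"
  then obtain r where r: "r > 0" "cball z r \<subseteq> (\<Sum>i\<in>I. dilate (t i) (convex hull (F i)))"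
    using mem_interior_cball by blast
  define \<Phi> where "\<Phi> x = (\<Sum>i\<in>I. t i * ln (partition_sum (F i) x)) - x \<bullet> z" for x
  \<comment> \<open>The bound is tested at the point of \<open>cball z r\<close> in direction
    \<open>x\<close>. For \<open>x = 0\<close> the division yields 0 and the point is
    \<open>z\<close>.\<close>
  have coercive: "\<Phi> x \<ge> r * norm x" for x
  proof -
    have "z + (r / norm x) *\<^sub>R x \<in> cball z r" using r(1) by (simp add: dist_norm)
    then have "x \<bullet> (z + (r / norm x) *\<^sub>R x) \<le> (\<Sum>i\<in>I. t i * ln (partition_sum (F i) x))"
      using r(2) by (intro inner_le_ln_partition_sum) auto
    moreover have "x \<bullet> (z + (r / norm x) *\<^sub>R x) = x \<bullet> z + r * norm x"
      by (simp add: inner_add_right dot_square_norm power2_eq_square)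
    ultimately show ?thesis by (simp add: \<Phi>_def)
  qed
  have deriv: "(\<Phi> has_derivative (\<lambda>h. (gradient_map x - z) \<bullet> h)) (at x)" for x
  proof -
    have "(\<Phi> has_derivative (\<lambda>h. (\<Sum>i\<in>I. t i * (tilted_mean (F i) x \<bullet> h)) - h \<bullet> z)) (at x)"
      unfolding \<Phi>_def
      by (intro has_derivative_diff has_derivative_sum has_derivative_mult_right
          has_derivative_ln_partition_sum F F_nonempty has_derivative_inner_left has_derivative_ident)
    then show ?thesis
      by (simp add: gradient_map_def inner_diff_left inner_sum_left inner_commute[of _ z])
  qed
  then have "continuous_on UNIV \<Phi>"
    by (meson continuous_at_imp_continuous_on has_derivative_continuous)
  \<comment> \<open>Beyond the radius \<open>\<Phi> 0 / r\<close>, coercivity forces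
    \<open>\<Phi> x > \<Phi> 0\<close>, so a minimum over this ball is a global one.\<close>
  then have "continuous_on (cball 0 (\<Phi> 0 / r)) \<Phi>" by (rule continuous_on_subset) auto
  moreover have "\<Phi> 0 \<ge> 0" using coercive[of 0] by simp
  ultimately have "\<exists>x0\<in>cball 0 (\<Phi> 0 / r). \<forall>x\<in>cball 0 (\<Phi> 0 / r). \<Phi> x0 \<le> \<Phi> x"
    using r(1) by (intro continuous_attains_inf) (auto simp: divide_less_0_iff)
  then obtain x0 where x0: "\<And>x. x \<in> cball 0 (\<Phi> 0 / r) \<Longrightarrow> \<Phi> x0 \<le> \<Phi> x"
    by blast
  have "\<Phi> x0 \<le> \<Phi> x" for x
  proof (cases "x \<in> cball 0 (\<Phi> 0 / r)")
    case False
    then have "\<Phi> 0 < r * norm x" using r(1) by (simp add: field_simps)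
    moreover have "\<Phi> x0 \<le> \<Phi> 0" using x0[of 0] \<open>\<Phi> 0 \<ge> 0\<close> r(1) by simp
    ultimately show ?thesis using coercive[of x] by linarith
  qed (use x0 in blast)
  then have "(\<lambda>h. (gradient_map x0 - z) \<bullet> h) = (\<lambda>v. 0)"
    using differential_zero_maxmin[of x0 UNIV \<Phi>, OF _ _ deriv] by auto
  then have "(gradient_map x0 - z) \<bullet> (gradient_map x0 - z) = 0" by metis
  then show "z \<in> range gradient_map" by auto
qed

text \<open>The image lies between the interior of the closed convex sum and the sum itself, and the
  frontier of a convex set is negligible.\<close>

lemma measure_range_gradient_map:
  "range gradient_map \<in> lmeasurable \<and>
   measure lebesgue (range gradient_map) = measure lebesgue (\<Sum>i\<in>I. dilate (t i) (convex hull (F i)))"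
proof -
  let ?P = "\<Sum>i\<in>I. dilate (t i) (convex hull (F i))"
  have P: "compact ?P" "convex ?P"
    by (auto intro!: compact_set_sum convex_set_sum compact_dilate convex_dilate finite_imp_compact_convex_hull F)
  have "negligible (frontier ?P)" by (rule negligible_convex_frontier[OF P(2)])
  moreover have "sym_diff ?P (range gradient_map) \<subseteq> frontier ?P"
    using gradient_map_in_sum interior_subset_range_gradient_map P(1)
    by (auto simp: frontier_def compact_imp_closed)
  ultimately have "negligible (sym_diff ?P (range gradient_map))"
    by (rule negligible_subset)
  then show ?thesis
    using lmeasurable_compact[OF P(1)] lmeasurable_negligible_symdiff measure_negligible_symdiff
    by (metis fmeasurableD)
qed

end

lemma matrix_sum_scaleR:
  fixes f :: "'i \<Rightarrow> real^'n \<Rightarrow> real^'m"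
  shows "matrix (\<lambda>h. \<Sum>i\<in>I. t i *\<^sub>R f i h) = (\<Sum>i\<in>I. t i *\<^sub>R matrix (f i))"
  by (simp add: matrix_def vec_eq_iff)

lemma has_integral_volume_polytope_sum_pos:
  fixes F :: "'i \<Rightarrow> (real^'n::{finite,wellorder}) set"
  assumes "finite I" "I \<noteq> {}" "\<And>i. i \<in> I \<Longrightarrow> t i > 0"
    and "\<And>i. i \<in> I \<Longrightarrow> finite (F i)" "\<And>i. i \<in> I \<Longrightarrow> interior (convex hull (F i)) \<noteq> {}"
  shows "((\<lambda>x. det (\<Sum>i\<in>I. t i *\<^sub>R matrix (tilted_cov (F i) x))) has_integral
           vol (\<Sum>i\<in>I. dilate (t i) (convex hull (F i)))) UNIV"
proof -
  note a = assms
  let ?L = "\<lambda>x h. \<Sum>i\<in>I. t i *\<^sub>R tilted_cov (F i) x h"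
  let ?G = "gradient_map F I t"
  have "((\<lambda>x. \<bar>det (matrix (?L x))\<bar>) has_integral measure lebesgue (range ?G)) UNIV"
    using has_measure_differentiable_image[of UNIV ?G ?L "measure lebesgue (range ?G)"]
      has_derivative_gradient_map[where F=F and I=I and t=t, OF a] inj_gradient_map[where F=F and I=I and t=t, OF a]
      measure_range_gradient_map[where F=F and I=I and t=t, OF a]
    by auto
  moreover have "det (matrix (?L x)) > 0" for x
  proof (rule det_pos_of_positive_definite)
    fix h :: "real^'n::_" assume h: "h \<noteq> 0"
    have "linear (?L x)"
      using has_derivative_linear[OF has_derivative_gradient_map[where F=F and I=I and t=t, OF a]] by blast
    then show "h \<bullet> (matrix (?L x) *v h) > 0"
      using inner_derivative_gradient_map_pos[where F=F and I=I and t=t, OF a h] by simp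
  qed
  ultimately show ?thesis
    using measure_range_gradient_map[where F=F and I=I and t=t, OF a] by (simp add: matrix_sum_scaleR abs_of_pos)
qed

lemma det_zero: "det (0::'a::comm_ring_1^'n^'n) = 0"
  by (simp add: det_def zero_power)

text \<open>Indices of weight zero drop out of both sides. If none remains, the determinant of the
  zero matrix faces the volume of a single point.\<close>

lemma has_integral_volume_polytope_sum:
  fixes F :: "'i \<Rightarrow> (real^'n::{finite,wellorder}) set"
  assumes I: "finite I" and t: "\<And>i. i \<in> I \<Longrightarrow> t i \<ge> 0"
    and F: "\<And>i. i \<in> I \<Longrightarrow> finite (F i)" "\<And>i. i \<in> I \<Longrightarrow> interior (convex hull (F i)) \<noteq> {}"
  shows "((\<lambda>x. det (\<Sum>i\<in>I. t i *\<^sub>R matrix (tilted_cov (F i) x))) has_integral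
           vol (\<Sum>i\<in>I. dilate (t i) (convex hull (F i)))) UNIV"
proof -
  define J where "J = {i\<in>I. t i > 0}"
  have J: "finite J" "J \<subseteq> I" using I by (auto simp: J_def)
  have t0: "t i = 0" if "i \<in> I - J" for i using that t[of i] by (auto simp: J_def)
  have "F i \<noteq> {}" if "i \<in> I" for i using F(2)[OF that] by auto
  then have "(\<Sum>i\<in>J. dilate (t i) (convex hull (F i))) = (\<Sum>i\<in>I. dilate (t i) (convex hull (F i)))"
    using t0 by (intro sum.mono_neutral_left I J) auto
  moreover have "(\<Sum>i\<in>J. t i *\<^sub>R matrix (tilted_cov (F i) x)) = (\<Sum>i\<in>I. t i *\<^sub>R matrix (tilted_cov (F i) x))" for x
    using t0 by (intro sum.mono_neutral_left I J) auto
  moreover have "((\<lambda>x. det (\<Sum>i\<in>J. t i *\<^sub>R matrix (tilted_cov (F i) x))) has_integral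
           vol (\<Sum>i\<in>J. dilate (t i) (convex hull (F i)))) UNIV"
  proof (cases "J = {}")
    case True
    then show ?thesis by (simp add: det_zero)
  next
    case False
    then show ?thesis using J F by (intro has_integral_volume_polytope_sum_pos) (auto simp: J_def)
  qed
  ultimately show ?thesis by simp
qed

section \<open>Polarization\<close>

lemma finite_range_subset: "finite A \<Longrightarrow> finite {\<phi>::'n::finite \<Rightarrow> 'b. range \<phi> \<subseteq> A}"
  using finite_set_of_finite_funs[of "UNIV::'n set" A undefined] by (simp add: image_subset_iff)

text \<open>Multilinearity in the rows: \<open>\<phi>\<close> chooses the summand from which each
  row is taken.\<close>

lemma det_sum_expand:
  fixes N :: "'k \<Rightarrow> real^'n^'n"
  assumes "finite S"
  shows "det (\<Sum>k\<in>S. N k) = (\<Sum>\<phi> | range \<phi> \<subseteq> S. det (\<chi> r. N (\<phi> r) $ r))"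
proof -
  have PiE: "(UNIV \<rightarrow>\<^sub>E S) = {\<phi>::'n \<Rightarrow> 'k. range \<phi> \<subseteq> S}" by (auto simp: PiE_UNIV_domain)
  have "det (\<Sum>k\<in>S. N k) = (\<Sum>p | p permutes UNIV. of_int (sign p) * (\<Prod>r\<in>UNIV. \<Sum>k\<in>S. N k $ r $ p r))"
    by (simp add: det_def)
  also have "\<dots> = (\<Sum>p | p permutes UNIV. \<Sum>\<phi> | range \<phi> \<subseteq> S. of_int (sign p) * (\<Prod>r\<in>UNIV. N (\<phi> r) $ r $ p r))"
    using assms by (simp add: prod_sum_PiE PiE sum_distrib_left)
  also have "\<dots> = (\<Sum>\<phi> | range \<phi> \<subseteq> S. det (\<chi> r. N (\<phi> r) $ r))"
    unfolding det_def by (subst sum.swap) simp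
  finally show ?thesis .
qed

text \<open>Moebius inversion of the previous expansion over the subsets of \<open>{..<n}\<close>.\<close>

lemma det_polarization:
  fixes N :: "nat \<Rightarrow> real^'n^'n"
  shows "(\<Sum>S\<in>Pow {..<n}. (- 1) ^ (n - card S) * det (\<Sum>k\<in>S. N k)) =
    (\<Sum>\<sigma> | range \<sigma> = {..<n}. det (\<chi> r. N (\<sigma> r) $ r))"
proof -
  \<comment> \<open>\<open>f T\<close> collects the row choices that use exactly the matrices
    indexed by \<open>T\<close>, so the determinant for \<open>S\<close> is the sum of
    \<open>f\<close> over the subsets of \<open>S\<close>.\<close>
  define f where "f T = (\<Sum>\<sigma> | range \<sigma> = T. det (\<chi> r. N (\<sigma> r) $ r))" for T
  have "det (\<Sum>k\<in>S. N k) = sum f (Pow S)" if "finite S" for S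
  proof -
    have "sum f (Pow S) = (\<Sum>T\<in>Pow S. \<Sum>\<sigma> | \<sigma> \<in> {\<phi>. range \<phi> \<subseteq> S} \<and> range \<sigma> = T. det (\<chi> r. N (\<sigma> r) $ r))"
      unfolding f_def by (intro sum.cong) auto
    also have "\<dots> = (\<Sum>\<sigma> | range \<sigma> \<subseteq> S. det (\<chi> r. N (\<sigma> r) $ r))"
      using that by (intro sum.group finite_range_subset) auto
    finally show ?thesis using det_sum_expand[OF that] by simp
  qed
  from inclusion_exclusion_mobius[OF this finite_lessThan[of n]] show ?thesis
    by (simp add: f_def)
qed

lemma bij_betw_of_range_eq:
  fixes \<sigma> :: "'n::finite \<Rightarrow> nat"
  assumes "range \<sigma> = {..<CARD('n)}"
  shows "bij_betw \<sigma> UNIV {..<CARD('n)}"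
  using assms by (simp add: bij_betw_def eq_card_imp_inj_on)

text \<open>These maps are bijections, so their number is the factorial of \<open>CARD('n)\<close>.
  Positivity permits the division by it in \<open>polarized_volume\<close>.\<close>

lemma card_surjections_pos: "card {\<sigma>::'n::finite \<Rightarrow> nat. range \<sigma> = {..<CARD('n)}} > 0"
proof -
  obtain h where "bij_betw h (UNIV::'n set) {0..<CARD('n)}"
    using ex_bij_betw_finite_nat[of "UNIV::'n set"] by auto
  then have "{\<sigma>::'n \<Rightarrow> nat. range \<sigma> = {..<CARD('n)}} \<noteq> {}"
    by (auto simp: bij_betw_def lessThan_atLeast0)
  moreover have "finite {\<sigma>::'n \<Rightarrow> nat. range \<sigma> = {..<CARD('n)}}"
    by (rule finite_subset[OF _ finite_range_subset[of "{..<CARD('n)}"]]) auto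
  ultimately show ?thesis by (simp add: card_gt_0_iff)
qed

text \<open>The bijection \<open>\<sigma>\<close> numbers the rows, which turns choice functions on
  rows into lists. The left side is the same for every numbering, so the numberings can be averaged
  later to obtain symmetric coefficients.\<close>

lemma det_weighted_sum_expand:
  fixes M :: "nat \<Rightarrow> real^'n^'n"
  assumes \<sigma>: "range (\<sigma>::'n \<Rightarrow> nat) = {..<CARD('n)}" and A: "finite A"
  shows "det (\<Sum>i\<in>A. t i *\<^sub>R M i) =
    (\<Sum>is | set is \<subseteq> A \<and> length is = CARD('n). det (\<chi> r. M (is ! \<sigma> r) $ r) * prod_list (map t is))"
proof -
  let ?n = "CARD('n)"
  have b: "bij_betw \<sigma> UNIV {..<?n}" by (rule bij_betw_of_range_eq[OF \<sigma>])
  define \<tau> where "\<tau> = inv_into UNIV \<sigma>"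
  have \<tau>: "\<tau> (\<sigma> r) = r" for r using b by (simp add: \<tau>_def bij_betw_def)
  have \<tau>': "\<sigma> (\<tau> k) = k" if "k < ?n" for k using \<sigma> that by (simp add: \<tau>_def f_inv_into_f)
  have \<sigma>_less: "\<sigma> r < ?n" for r using \<sigma> by auto
  have "det (\<Sum>i\<in>A. t i *\<^sub>R M i) = (\<Sum>\<phi> | range \<phi> \<subseteq> A. det (\<chi> r. t (\<phi> r) *s (M (\<phi> r) $ r)))"
    unfolding det_sum_expand[OF A] by (simp add: scalar_mult_eq_scaleR)
  also have "\<dots> = (\<Sum>\<phi> | range \<phi> \<subseteq> A. (\<Prod>r\<in>UNIV. t (\<phi> r)) * det (\<chi> r. M (\<phi> r) $ r))"
    by (simp add: det_rows_mul)
  also have "\<dots> = (\<Sum>is | set is \<subseteq> A \<and> length is = ?n. det (\<chi> r. M (is ! \<sigma> r) $ r) * prod_list (map t is))"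
  proof (rule sum.reindex_bij_witness[where i = "\<lambda>is (r::'n). is ! \<sigma> r" and j = "\<lambda>\<phi>. map (\<lambda>k. \<phi> (\<tau> k)) [0..<?n]"])
    fix \<phi> :: "'n \<Rightarrow> nat" assume "\<phi> \<in> {\<phi>. range \<phi> \<subseteq> A}"
    have eq: "(\<lambda>r. map (\<lambda>k. \<phi> (\<tau> k)) [0..<?n] ! \<sigma> r) = \<phi>"
      using \<sigma>_less \<tau> by (auto simp: fun_eq_iff)
    have "(\<Prod>r\<in>UNIV. t (\<phi> r)) = (\<Prod>r\<in>UNIV. t (\<phi> (\<tau> (\<sigma> r))))" by (simp add: \<tau>)
    also have "\<dots> = (\<Prod>k<?n. t (\<phi> (\<tau> k)))" by (rule prod.reindex_bij_betw[OF b])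
    finally have "prod_list (map t (map (\<lambda>k. \<phi> (\<tau> k)) [0..<?n])) = (\<Prod>r\<in>UNIV. t (\<phi> r))"
      by (simp add: prod.list_conv_set_nth lessThan_atLeast0)
    then show "det (\<chi> r. M (map (\<lambda>k. \<phi> (\<tau> k)) [0..<?n] ! \<sigma> r) $ r) * prod_list (map t (map (\<lambda>k. \<phi> (\<tau> k)) [0..<?n]))
        = (\<Prod>r\<in>UNIV. t (\<phi> r)) * det (\<chi> r. M (\<phi> r) $ r)"
      by (simp only: fun_cong[OF eq] mult.commute)
  qed (use \<sigma>_less \<tau> \<tau>' in \<open>auto simp: fun_eq_iff list_eq_iff_nth_eq image_subset_iff subset_iff\<close>)
  finally show ?thesis .
qed

text \<open>For a form of degree \<open>n\<close> and \<open>g S\<close> its value at the sum of the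
  vectors indexed by \<open>S\<close>, this is \<open>n\<close> factorial times the symmetric
  multilinear form.\<close>

definition polarization :: "nat \<Rightarrow> (nat set \<Rightarrow> real) \<Rightarrow> real" where
  "polarization n g = (\<Sum>S\<in>Pow {..<n}. (- 1) ^ (n - card S) * g S)"

text \<open>The expansion is summed over all numberings \<open>\<sigma>\<close>, and
  \<open>det_polarization\<close> evaluates the coefficients. They are now linear in determinants of
  unweighted sums, each of which integrates to a volume.\<close>

lemma det_weighted_sum_polarization:
  fixes M :: "nat \<Rightarrow> real^'n^'n"
  assumes A: "finite A"
  shows "real (card {\<sigma>::'n \<Rightarrow> nat. range \<sigma> = {..<CARD('n)}}) * det (\<Sum>i\<in>A. t i *\<^sub>R M i) =
    (\<Sum>is | set is \<subseteq> A \<and> length is = CARD('n).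
       polarization CARD('n) (\<lambda>S. det (\<Sum>k\<in>S. M (is ! k))) * prod_list (map t is))"
proof -
  let ?B = "{\<sigma>::'n \<Rightarrow> nat. range \<sigma> = {..<CARD('n)}}"
  have "real (card ?B) * det (\<Sum>i\<in>A. t i *\<^sub>R M i) = (\<Sum>\<sigma>\<in>?B. det (\<Sum>i\<in>A. t i *\<^sub>R M i))" by simp
  also have "\<dots> = (\<Sum>\<sigma>\<in>?B. \<Sum>is | set is \<subseteq> A \<and> length is = CARD('n).
      det (\<chi> r. M (is ! \<sigma> r) $ r) * prod_list (map t is))"
    by (intro sum.cong refl det_weighted_sum_expand A) simp
  also have "\<dots> = (\<Sum>is | set is \<subseteq> A \<and> length is = CARD('n).
      (\<Sum>\<sigma>\<in>?B. det (\<chi> r. M (is ! \<sigma> r) $ r)) * prod_list (map t is))"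
    unfolding sum_distrib_right by (rule sum.swap)
  finally show ?thesis unfolding polarization_def det_polarization .
qed

text \<open>The explicit candidate for the mixed volume: alternating volumes of partial Minkowski
  sums, divided by the factorial of the dimension.\<close>

definition polarized_volume :: "(real^'n) set list \<Rightarrow> real" where
  "polarized_volume Ks = polarization CARD('n) (\<lambda>S. vol (\<Sum>k\<in>S. Ks ! k)) /
     real (card {\<sigma>::'n \<Rightarrow> nat. range \<sigma> = {..<CARD('n)}})"

lemma dilate_1 [simp]: "dilate 1 K = K"
  by (simp add: dilate_def)

text \<open>The pointwise polarization identity for the Hessians is integrated over the whole space;
  both sides become combinations of volumes.\<close>

lemma polarized_volume_polytopes:
  fixes F :: "nat \<Rightarrow> (real^'n::{finite,wellorder}) set"
  assumes A: "finite A" and t: "\<And>i. i \<in> A \<Longrightarrow> t i \<ge> 0"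
    and F: "\<And>i. i \<in> A \<Longrightarrow> finite (F i)" "\<And>i. i \<in> A \<Longrightarrow> interior (convex hull (F i)) \<noteq> {}"
  shows "vol (\<Sum>i\<in>A. dilate (t i) (convex hull (F i))) =
    (\<Sum>is | set is \<subseteq> A \<and> length is = CARD('n).
       polarized_volume (map (\<lambda>i. convex hull (F i)) is) * prod_list (map t is))"
proof -
  let ?n = "CARD('n)" and ?L = "{is. set is \<subseteq> A \<and> length is = CARD('n)}"
  define c where "c = real (card {\<sigma>::'n \<Rightarrow> nat. range \<sigma> = {..<?n}})"
  have c: "c > 0" unfolding c_def using card_surjections_pos by simp
  have fin: "finite ?L" using A by (simp add: finite_lists_length_eq)
  let ?P = "\<lambda>is. polarization ?n (\<lambda>S. vol (\<Sum>k\<in>S. convex hull (F (is ! k))))"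
  have "((\<lambda>x. \<Sum>is\<in>?L. polarization ?n (\<lambda>S. det (\<Sum>k\<in>S. matrix (tilted_cov (F (is ! k)) x))) * prod_list (map t is))
      has_integral (\<Sum>is\<in>?L. ?P is * prod_list (map t is))) UNIV"
  proof (intro has_integral_sum fin has_integral_mult_left)
    fix "is" assume iL: "is \<in> ?L"
    show "((\<lambda>x. polarization ?n (\<lambda>S. det (\<Sum>k\<in>S. matrix (tilted_cov (F (is ! k)) x)))) has_integral ?P is) UNIV"
      unfolding polarization_def
    proof (intro has_integral_sum has_integral_mult_right)
      fix S assume S: "S \<in> Pow {..<?n}"
      then have "is ! k \<in> A" if "k \<in> S" for k using iL that by (auto simp: subset_iff)
      moreover have "finite S" using S finite_subset by auto
      ultimately show "((\<lambda>x. det (\<Sum>k\<in>S. matrix (tilted_cov (F (is ! k)) x))) has_integral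
          vol (\<Sum>k\<in>S. convex hull (F (is ! k)))) UNIV"
        using has_integral_volume_polytope_sum[of S "\<lambda>k. 1" "\<lambda>k. F (is ! k)"] F by auto
    qed auto
  qed
  \<comment> \<open>By \<open>det_weighted_sum_polarization\<close> this is the same integrand, so
    uniqueness of the integral equates the two values.\<close>
  moreover have "((\<lambda>x. c * det (\<Sum>i\<in>A. t i *\<^sub>R matrix (tilted_cov (F i) x))) has_integral
      c * vol (\<Sum>i\<in>A. dilate (t i) (convex hull (F i)))) UNIV"
    using has_integral_volume_polytope_sum[OF A t F] by (intro has_integral_mult_right)
  ultimately have "c * vol (\<Sum>i\<in>A. dilate (t i) (convex hull (F i))) = (\<Sum>is\<in>?L. ?P is * prod_list (map t is))"
    unfolding c_def det_weighted_sum_polarization[OF A] by (rule has_integral_unique[rotated])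
  moreover have "c * polarized_volume (map (\<lambda>i. convex hull (F i)) is) = ?P is" if "is \<in> ?L" for "is"
  proof -
    have "(\<Sum>k\<in>S. map (\<lambda>i. convex hull (F i)) is ! k) = (\<Sum>k\<in>S. convex hull (F (is ! k)))"
      if "S \<in> Pow {..<?n}" for S
      using that \<open>is \<in> ?L\<close> by (intro sum.cong) auto
    then show ?thesis using c unfolding polarized_volume_def c_def[symmetric] polarization_def by simp
  qed
  ultimately have "c * vol (\<Sum>i\<in>A. dilate (t i) (convex hull (F i))) =
      c * (\<Sum>is\<in>?L. polarized_volume (map (\<lambda>i. convex hull (F i)) is) * prod_list (map t is))"
    by (simp add: sum_distrib_left mult.assoc[symmetric])
  then show ?thesis using c by simp
qed

section \<open>Passage to compact convex sets\<close>

text \<open>Finitely many small balls centered in \<open>K\<close> cover \<open>K\<close>. The hull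
  of the centers plus a small cube contains these balls and stays within distance \<open>e\<close>
  of \<open>K\<close>.\<close>

lemma polytope_outer_approximation:
  fixes K :: "'a::euclidean_space set"
  assumes K: "K \<in> convex_bodies" and e: "e > 0"
  obtains F where "finite F" "interior (convex hull F) \<noteq> {}" "K \<subseteq> convex hull F"
    "convex hull F \<subseteq> K + cball 0 e"
proof -
  have cK: "compact K" "convex K" "K \<noteq> {}" using K by (auto simp: convex_bodies_def)
  \<comment> \<open>The cube of half-side \<open>d\<close> contains the ball of radius
    \<open>d\<close>. It lies in \<open>cball 0 e\<close>, because the norm is at most the l1 norm,
    hence at most \<open>DIM('a) * d = e\<close>.\<close>
  define d where "d = e / real DIM('a)"
  have d: "d > 0" using e by (simp add: d_def)
  obtain S :: "'a set" where S: "finite S"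
    "cbox (0 - (\<Sum>i\<in>Basis. d *\<^sub>R i)) (0 + (\<Sum>i\<in>Basis. d *\<^sub>R i)) = convex hull S"
    using cube_convex_hull[OF d] by metis
  have mem: "x \<in> convex hull S \<longleftrightarrow> (\<forall>i\<in>Basis. \<bar>x \<bullet> i\<bar> \<le> d)" for x
    unfolding S(2)[symmetric] mem_box by (auto simp: abs_le_iff inner_diff_left)
  have ball: "ball 0 d \<subseteq> convex hull S"
    by (auto simp: mem intro!: order_trans[OF Basis_le_norm less_imp_le])
  have cball: "convex hull S \<subseteq> cball 0 e"
  proof
    fix x assume "x \<in> convex hull S"
    then have "(\<Sum>i\<in>Basis. \<bar>x \<bullet> i\<bar>) \<le> (\<Sum>i\<in>(Basis::'a set). d)" by (intro sum_mono) (simp add: mem)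
    then show "x \<in> cball 0 e" using norm_le_l1[of x] by (simp add: d_def)
  qed
  obtain T where T: "T \<subseteq> K" "finite T" "K \<subseteq> (\<Union>c\<in>T. ball c d)"
    using compactE_image[OF cK(1), of K "\<lambda>c. ball c d"] d by force
  show ?thesis
  proof (rule that[of "T + S"])
    have hull: "convex hull (T + S) = convex hull T + convex hull S" by (rule convex_hull_set_plus)
    have sub: "ball c d \<subseteq> convex hull (T + S)" if "c \<in> T" for c
    proof
      fix x assume "x \<in> ball c d"
      then have "x - c \<in> convex hull S" using ball by (auto simp: dist_norm norm_minus_commute)
      then have "c + (x - c) \<in> convex hull T + convex hull S" using that by (meson set_plus_intro hull_inc)
      then show "x \<in> convex hull (T + S)" unfolding hull by simp
    qed
    show "finite (T + S)" by (intro finite_set_plus T S)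
    show "K \<subseteq> convex hull (T + S)" using T(3) sub by blast
    obtain c where "c \<in> T" using T(3) cK(3) by blast
    then have "ball c d \<subseteq> interior (convex hull (T + S))" using sub by (simp add: interior_maximal)
    then show "interior (convex hull (T + S)) \<noteq> {}" using d by force
    have "convex hull T \<subseteq> K" using T(1) cK(2) by (rule hull_minimal)
    then show "convex hull (T + S) \<subseteq> K + cball 0 e" unfolding hull using cball by (rule set_plus_mono2)
  qed
qed

lemma set_sum_mono:
  fixes A B :: "'i \<Rightarrow> 'a::comm_monoid_add set"
  assumes "\<And>i. i \<in> I \<Longrightarrow> A i \<subseteq> B i"
  shows "(\<Sum>i\<in>I. A i) \<subseteq> (\<Sum>i\<in>I. B i)"
  using assms
proof (induction I rule: infinite_finite_induct)
  case (insert i I)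
  then have "A i + sum A I \<subseteq> B i + sum B I" by (intro set_plus_mono2) auto
  then show ?case using insert by simp
qed auto

lemma dilate_mono: "A \<subseteq> B \<Longrightarrow> dilate t A \<subseteq> dilate t B"
  unfolding dilate_def by (rule image_mono)

lemma dilate_set_plus: "dilate t (A + B) = dilate t A + dilate t B"
proof -
  have "dilate t (A + B) = (\<Union>a\<in>A. \<Union>b\<in>B. {t *\<^sub>R (a + b)})"
    by (auto simp: dilate_def set_plus_def)
  also have "\<dots> = (\<Union>a\<in>A. \<Union>b\<in>B. {t *\<^sub>R a + t *\<^sub>R b})" by (simp only: scaleR_add_right)
  also have "\<dots> = dilate t A + dilate t B" by (auto simp: dilate_def set_plus_def)
  finally show ?thesis .
qed

lemma set_sum_dilate_cball_subset:
  fixes t :: "'i \<Rightarrow> real"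
  assumes "\<And>i. i \<in> I \<Longrightarrow> t i \<ge> 0" and r: "r \<ge> 0"
  shows "(\<Sum>i\<in>I. dilate (t i) (cball 0 r)) \<subseteq> (cball 0 (sum t I * r) :: 'a::real_normed_vector set)"
  using assms(1)
proof (induction I rule: infinite_finite_induct)
  case (insert i I)
  have "dilate (t i) (cball (0::'a) r) \<subseteq> cball 0 (t i * r)"
    using insert.prems[of i] by (auto simp: dilate_def intro!: mult_left_mono)
  moreover have "cball (0::'a) a + cball 0 b \<subseteq> cball 0 (a + b)" for a b
    by (auto simp: set_plus_def intro: norm_triangle_mono)
  ultimately have "dilate (t i) (cball (0::'a) r) + (\<Sum>i\<in>I. dilate (t i) (cball 0 r)) \<subseteq> cball 0 (t i * r + sum t I * r)"
    using insert by (meson insertCI set_plus_mono2 subset_trans)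
  then show ?case using insert by (simp add: distrib_right)
qed (use r in auto)

lemma set_sum_dilate_enlarge:
  fixes K :: "'i \<Rightarrow> 'a::real_normed_vector set"
  assumes t: "\<And>i. i \<in> I \<Longrightarrow> t i \<ge> 0" and r: "r \<ge> 0" and P: "\<And>i. i \<in> I \<Longrightarrow> P i \<subseteq> K i + cball 0 r"
  shows "(\<Sum>i\<in>I. dilate (t i) (P i)) \<subseteq> (\<Sum>i\<in>I. dilate (t i) (K i)) + cball 0 (sum t I * r)"
proof -
  have "(\<Sum>i\<in>I. dilate (t i) (P i)) \<subseteq> (\<Sum>i\<in>I. dilate (t i) (K i + cball 0 r))"
    by (intro set_sum_mono dilate_mono P)
  also have "\<dots> = (\<Sum>i\<in>I. dilate (t i) (K i)) + (\<Sum>i\<in>I. dilate (t i) (cball 0 r))"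
    by (simp add: dilate_set_plus sum.distrib)
  also have "\<dots> \<subseteq> (\<Sum>i\<in>I. dilate (t i) (K i)) + cball 0 (sum t I * r)"
    by (intro set_plus_mono2 order_refl set_sum_dilate_cball_subset t r)
  finally show ?thesis .
qed

text \<open>The approximating sums contain the limit set and eventually lie in any given open
  neighborhood of it; outer regularity supplies one of nearly the same volume.\<close>

lemma tendsto_vol_set_sum:
  fixes K :: "'i \<Rightarrow> (real^'n) set"
  assumes I: "finite I" and t: "\<And>i. i \<in> I \<Longrightarrow> t i \<ge> 0" and K: "\<And>i. i \<in> I \<Longrightarrow> compact (K i)"
    and P: "\<And>i j. i \<in> I \<Longrightarrow> compact (P j i)" "\<And>i j. i \<in> I \<Longrightarrow> K i \<subseteq> P j i"
      "\<And>i j. i \<in> I \<Longrightarrow> P j i \<subseteq> K i + cball 0 (1 / real (Suc j))"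
  shows "(\<lambda>j. vol (\<Sum>i\<in>I. dilate (t i) (P j i))) \<longlonglongrightarrow> vol (\<Sum>i\<in>I. dilate (t i) (K i))"
proof (rule LIMSEQ_I)
  let ?L = "\<Sum>i\<in>I. dilate (t i) (K i)" and ?P = "\<lambda>j. \<Sum>i\<in>I. dilate (t i) (P j i)"
  fix e :: real assume e: "e > 0"
  have L: "compact ?L" by (intro compact_set_sum compact_dilate K)
  have Lm: "?L \<in> lmeasurable" by (rule lmeasurable_compact[OF L])
  have Pm: "?P j \<in> lmeasurable" for j by (intro lmeasurable_compact compact_set_sum compact_dilate P)
  obtain U where U: "open U" "?L \<subseteq> U" "U - ?L \<in> lmeasurable" "emeasure lebesgue (U - ?L) < ennreal e"
    using sets_lebesgue_outer_open[OF fmeasurableD[OF Lm] e] by blast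
  have "?L \<union> (U - ?L) = U" using U(2) by blast
  with fmeasurable.Un[OF Lm U(3)] have Um: "U \<in> lmeasurable" by (simp only:)
  have Ue: "measure lebesgue U < vol ?L + e"
  proof -
    have "measure lebesgue (U - ?L) < e"
      using U(3,4) e by (simp add: emeasure_eq_measure2 ennreal_less_iff)
    moreover have "measure lebesgue (U - ?L) = measure lebesgue U - vol ?L"
      by (rule measurable_measure_Diff[OF Um fmeasurableD[OF Lm] U(2)])
    ultimately show ?thesis by simp
  qed
  obtain \<delta> where \<delta>: "\<delta> > 0" "(\<Union>x\<in>?L. ball x \<delta>) \<subseteq> U"
    using compact_subset_open_imp_ball_epsilon_subset[OF L U(1,2)] by blast
  define T where "T = sum t I"
  \<comment> \<open>From index \<open>N\<close> on, the enlargement radius \<open>T / Suc j\<close>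
    is less than \<open>\<delta>\<close>.\<close>
  obtain N where N: "T / \<delta> < real N" using reals_Archimedean2 by blast
  have sub1: "?L \<subseteq> ?P j" for j
    by (intro set_sum_mono dilate_mono P)
  have sub2: "?P j \<subseteq> U" if "j \<ge> N" for j
  proof
    fix w assume "w \<in> ?P j"
    then have "w \<in> ?L + cball 0 (T * (1 / real (Suc j)))"
      using set_sum_dilate_enlarge[of I t "1 / real (Suc j)" "P j" K, OF t _ P(3)] T_def by auto
    then obtain u v where uv: "w = u + v" "u \<in> ?L" "norm v \<le> T / real (Suc j)"
      by (auto elim!: set_plus_elim)
    have "T / \<delta> < real (Suc j)" using N that by simp
    then have "T / real (Suc j) < \<delta>" using \<delta>(1) by (simp add: field_simps del: of_nat_Suc)
    then have "w \<in> ball u \<delta>" using uv by (simp add: dist_norm)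
    then show "w \<in> U" using uv(2) \<delta>(2) by blast
  qed
  show "\<exists>no. \<forall>j\<ge>no. norm (vol (?P j) - vol ?L) < e"
  proof (intro exI allI impI)
    fix j assume "j \<ge> N"
    have "vol ?L \<le> vol (?P j)" by (rule measure_mono_fmeasurable[OF sub1 fmeasurableD[OF Lm] Pm])
    moreover have "vol (?P j) \<le> measure lebesgue U"
      by (rule measure_mono_fmeasurable[OF sub2[OF \<open>j \<ge> N\<close>] fmeasurableD[OF Pm] Um])
    ultimately show "norm (vol (?P j) - vol ?L) < e" using Ue by simp
  qed
qed

text \<open>Both sides are finite combinations of volumes of Minkowski sums, hence limits of their
  values at outer polytope approximations.\<close>

lemma polarized_volume_formula:
  fixes K :: "nat \<Rightarrow> (real^'n::{finite,wellorder}) set"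
  assumes A: "finite A" and t: "\<And>i. i \<in> A \<Longrightarrow> t i \<ge> 0" and K: "\<And>i. i \<in> A \<Longrightarrow> K i \<in> convex_bodies"
  shows "vol (\<Sum>i\<in>A. dilate (t i) (K i)) =
    (\<Sum>is | set is \<subseteq> A \<and> length is = CARD('n). polarized_volume (map K is) * prod_list (map t is))"
proof -
  let ?L = "{is. set is \<subseteq> A \<and> length is = CARD('n)}"
  have "\<forall>j. \<forall>i\<in>A. \<exists>F. finite F \<and> interior (convex hull F) \<noteq> {} \<and> K i \<subseteq> convex hull F \<and>
      convex hull F \<subseteq> K i + cball 0 (1 / real (Suc j))"
    by (metis K polytope_outer_approximation of_nat_0_less_iff zero_less_Suc zero_less_divide_1_iff)
  then obtain F where F: "\<And>i j. i \<in> A \<Longrightarrow> finite (F j i)" "\<And>i j. i \<in> A \<Longrightarrow> interior (convex hull (F j i)) \<noteq> {}"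
    "\<And>i j. i \<in> A \<Longrightarrow> K i \<subseteq> convex hull (F j i)"
    "\<And>i j. i \<in> A \<Longrightarrow> convex hull (F j i) \<subseteq> K i + cball 0 (1 / real (Suc j))"
    by metis
  define P where "P j i = convex hull (F j i)" for j i
  have cK: "i \<in> A \<Longrightarrow> compact (K i)" for i using K by (auto simp: convex_bodies_def)
  have cP: "i \<in> A \<Longrightarrow> compact (P j i)" for i j unfolding P_def by (intro finite_imp_compact_convex_hull F)
  have "(\<lambda>j. vol (\<Sum>i\<in>A. dilate (t i) (P j i))) \<longlonglongrightarrow> vol (\<Sum>i\<in>A. dilate (t i) (K i))"
    by (intro tendsto_vol_set_sum A t cK cP) (auto simp: P_def F simp del: of_nat_Suc)
  moreover have "(\<lambda>j. \<Sum>is\<in>?L. polarized_volume (map (P j) is) * prod_list (map t is)) \<longlonglongrightarrow>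
      (\<Sum>is\<in>?L. polarized_volume (map K is) * prod_list (map t is))"
  proof (intro tendsto_sum tendsto_mult_right)
    fix "is" assume iL: "is \<in> ?L"
    show "(\<lambda>j. polarized_volume (map (P j) is)) \<longlonglongrightarrow> polarized_volume (map K is)"
      unfolding polarized_volume_def polarization_def
    proof (intro tendsto_divide tendsto_sum tendsto_mult_left tendsto_const)
      fix S assume S: "S \<in> Pow {..<CARD('n)}"
      have A': "is ! k \<in> A" if "k \<in> S" for k using iL S that by (auto simp: subset_iff)
      have "finite S" using S finite_subset by auto
      \<comment> \<open>Weights equal to 1 bring the plain sums into the form treated by
        \<open>tendsto_vol_set_sum\<close>.\<close>
      have eq: "(\<Sum>k\<in>S. map f is ! k) = (\<Sum>k\<in>S. dilate 1 (f (is ! k)))" for f :: "nat \<Rightarrow> (real^'n::_) set"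
        using iL S by (intro sum.cong) auto
      show "(\<lambda>j. vol (\<Sum>k\<in>S. map (P j) is ! k)) \<longlonglongrightarrow> vol (\<Sum>k\<in>S. map K is ! k)"
        unfolding eq using A'
        by (intro tendsto_vol_set_sum \<open>finite S\<close> cK cP) (auto simp: P_def F simp del: of_nat_Suc)
    qed (use card_surjections_pos[where 'n='n] in simp)
  qed
  moreover have "vol (\<Sum>i\<in>A. dilate (t i) (P j i)) =
      (\<Sum>is\<in>?L. polarized_volume (map (P j) is) * prod_list (map t is))" for j
    unfolding P_def by (rule polarized_volume_polytopes[OF A t F(1,2)])
  ultimately show ?thesis by (simp only: LIMSEQ_unique)
qed

text \<open>Permuting the list permutes the subsets in the alternating sum and preserves their
  cardinalities, hence the signs.\<close>

lemma polarized_volume_mset: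
  fixes Ks :: "(real^'n) set list"
  assumes "length Ks = CARD('n)" "mset Ls = mset Ks"
  shows "polarized_volume Ls = polarized_volume Ks"
proof -
  let ?n = "CARD('n)"
  obtain p where p: "p permutes {..<?n}" "permute_list p Ks = Ls"
    using mset_eq_permutation[OF assms(2)] assms(1) by metis
  have "polarization ?n (\<lambda>S. vol (\<Sum>k\<in>S. Ls ! k)) = polarization ?n (\<lambda>S. vol (\<Sum>k\<in>S. Ks ! k))"
    unfolding polarization_def
  proof (rule sum.reindex_bij_betw[of "(`) p", THEN trans[rotated]])
    show "bij_betw ((`) p) (Pow {..<?n}) (Pow {..<?n})"
      by (intro bij_betw_Pow permutes_imp_bij[OF p(1)])
    have inj: "inj_on p S" for S using permutes_inj_on[OF p(1)] .
    show "(\<Sum>S\<in>Pow {..<?n}. (- 1) ^ (?n - card S) * vol (\<Sum>k\<in>S. Ls ! k)) =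
       (\<Sum>S\<in>Pow {..<?n}. (- 1) ^ (?n - card (p ` S)) * vol (\<Sum>k\<in>p ` S. Ks ! k))"
    proof (intro sum.cong refl)
      fix S assume "S \<in> Pow {..<?n}"
      then have "(\<Sum>k\<in>S. Ls ! k) = (\<Sum>k\<in>S. Ks ! p k)"
        unfolding p(2)[symmetric] using p(1) assms(1) by (intro sum.cong refl permute_list_nth) auto
      then show "(- 1) ^ (?n - card S) * vol (\<Sum>k\<in>S. Ls ! k) =
          (- 1) ^ (?n - card (p ` S)) * vol (\<Sum>k\<in>p ` S. Ks ! k)"
        by (simp add: sum.reindex[OF inj] card_image[OF inj] o_def)
    qed
  qed
  then show ?thesis by (simp add: polarized_volume_def)
qed

lemma is_mixed_volume_polarized_volume:
  "is_mixed_volume (polarized_volume :: (real^'n::{finite,wellorder}) set list \<Rightarrow> real)"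
  unfolding is_mixed_volume_def
  by (intro conjI allI impI polarized_volume_formula) (auto intro: polarized_volume_mset)

section \<open>Arbitrary finite index types\<close>

text \<open>
  The change of variables theorem of the library requires the index type to be well-ordered. The present
  type has as many elements as \<open>'n\<close> and carries the order of the natural numbers.
\<close>

typedef ('n::finite) ordered_index = "{..<CARD('n)}"
  by (auto simp: zero_less_card_finite intro!: exI[of _ 0])

instantiation ordered_index :: (finite) "{finite, wellorder}"
begin

definition less_eq_ordered_index :: "'a ordered_index \<Rightarrow> 'a ordered_index \<Rightarrow> bool" where
  "x \<le> y \<longleftrightarrow> Rep_ordered_index x \<le> Rep_ordered_index y"

definition less_ordered_index :: "'a ordered_index \<Rightarrow> 'a ordered_index \<Rightarrow> bool" where
  "x < y \<longleftrightarrow> Rep_ordered_index x < Rep_ordered_index y"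

instance
proof
  show "finite (UNIV :: 'a ordered_index set)"
    using type_definition.univ[OF type_definition_ordered_index] by (metis finite_imageI finite_lessThan)
next
  fix P and a :: "'a ordered_index"
  assume step: "\<And>x::'a ordered_index. (\<And>y. y < x \<Longrightarrow> P y) \<Longrightarrow> P x"
  show "P a"
    by (induction a rule: measure_induct_rule[of Rep_ordered_index])
      (rule step, simp add: less_ordered_index_def)
qed (auto simp: less_eq_ordered_index_def less_ordered_index_def Rep_ordered_index_inject)

end

lemma card_ordered_index: "CARD('n::finite ordered_index) = CARD('n)"
  by (simp add: type_definition.card[OF type_definition_ordered_index])

definition reindex :: "('m::finite \<Rightarrow> 'n::finite) \<Rightarrow> real^'n \<Rightarrow> real^'m" where
  "reindex g x = (\<chi> i. x $ g i)"

lemma linear_reindex: "linear (reindex g)"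
  by (rule linearI) (auto simp: reindex_def vec_eq_iff)

lemma inj_reindex: "surj g \<Longrightarrow> inj (reindex g)"
  by (rule injI) (metis reindex_def surjD vec_eq_iff vec_lambda_beta)

lemma prod_Basis_cart:
  fixes f :: "real^'n \<Rightarrow> 'b::comm_monoid_mult"
  shows "(\<Prod>b\<in>Basis. f b) = (\<Prod>i\<in>UNIV. f (axis i 1))"
proof -
  have inj: "inj (\<lambda>i::'n. axis i (1::real))" by (auto simp: inj_on_def axis_eq_axis)
  have Basis: "(Basis :: (real^'n) set) = range (\<lambda>i. axis i 1)" by (auto simp: Basis_vec_def)
  show ?thesis unfolding Basis by (simp only: prod.reindex[OF inj] o_def)
qed

text \<open>Lebesgue measure is determined by its values on boxes, and relabelling coordinates
  merely permutes the side lengths of a box.\<close>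

lemma lborel_distr_reindex:
  fixes g :: "'m::finite \<Rightarrow> 'n::finite"
  assumes g: "bij g"
  shows "distr lborel borel (reindex g) = lborel"
proof (rule sym, rule lborel_eqI)
  have meas: "reindex g \<in> borel_measurable borel"
    by (intro borel_measurable_continuous_onI linear_continuous_on linear_conv_bounded_linear[THEN iffD1] linear_reindex)
  fix l u :: "real^'m" assume "\<And>b. b \<in> Basis \<Longrightarrow> l \<bullet> b \<le> u \<bullet> b"
  then have le: "l $ i \<le> u $ i" for i by (metis axis_in_Basis_iff cart_eq_inner_axis Basis_real_def singletonI)
  let ?l = "reindex (inv g) l" and ?u = "reindex (inv g) u"
  have vimage: "reindex g -` box l u = box ?l ?u"
    using g by (auto simp: mem_box_cart reindex_def bij_is_surj surj_f_inv_f) (metis bij_inv_eq_iff)+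
  have "emeasure (distr lborel borel (reindex g)) (box l u) = emeasure lborel (box ?l ?u)"
    using meas by (simp add: emeasure_distr vimage)
  also have "\<dots> = (\<Prod>i\<in>UNIV. ?u $ i - ?l $ i)"
  proof (subst emeasure_lborel_box)
    show "?l \<bullet> b \<le> ?u \<bullet> b" if "b \<in> Basis" for b
      using le that by (auto simp: Basis_vec_def inner_axis reindex_def)
  qed (simp add: prod_Basis_cart inner_axis)
  also have "\<dots> = (\<Prod>i\<in>UNIV. (u - l) $ inv g i)" by (simp add: reindex_def)
  also have "(\<Prod>i\<in>UNIV. (u - l) $ inv g i) = (\<Prod>i\<in>UNIV. (u - l) $ i)"
    by (rule prod.reindex_bij_betw[OF bij_imp_bij_inv[OF g]])
  also have "\<dots> = (\<Prod>b\<in>Basis. (u - l) \<bullet> b)" by (simp add: prod_Basis_cart inner_axis)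
  finally show "emeasure (distr lborel borel (reindex g)) (box l u) = ennreal (\<Prod>b\<in>Basis. (u - l) \<bullet> b)" .
qed simp

text \<open>Compact sets are Borel, so their volume can be computed with \<open>lborel\<close>,
  which \<open>reindex\<close> preserves.\<close>

lemma vol_reindex:
  fixes S :: "(real^'n) set" and g :: "'m::finite \<Rightarrow> 'n"
  assumes g: "bij g" and S: "compact S"
  shows "vol (reindex g ` S) = vol S"
proof -
  have lin: "bounded_linear (reindex g)" using linear_reindex linear_conv_bounded_linear by blast
  have S': "compact (reindex g ` S)"
    by (intro compact_continuous_image linear_continuous_on lin S)
  have meas: "reindex g \<in> borel_measurable borel"
    by (intro borel_measurable_continuous_onI linear_continuous_on lin)
  have "vol (reindex g ` S) = measure (distr lborel borel (reindex g)) (reindex g ` S)"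
    using S' by (simp add: lborel_distr_reindex[OF g] borel_compact)
  also have "\<dots> = measure lborel (reindex g -` reindex g ` S)"
    using meas S' by (simp add: measure_distr borel_compact)
  also have "\<dots> = vol S"
    using S by (simp add: inj_vimage_image_eq inj_reindex bij_is_surj[OF g] borel_compact)
  finally show ?thesis .
qed

lemma linear_image_set_plus:
  assumes "linear f" shows "f ` (A + B) = f ` A + f ` B"
proof -
  have "f ` (A + B) = (\<Union>a\<in>A. \<Union>b\<in>B. {f (a + b)})" by (auto simp: set_plus_def)
  also have "\<dots> = (\<Union>a\<in>A. \<Union>b\<in>B. {f a + f b})" by (simp only: linear_add[OF assms])
  also have "\<dots> = f ` A + f ` B" by (auto simp: set_plus_def)
  finally show ?thesis .
qed

lemma linear_image_set_sum:
  assumes "linear f"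
  shows "f ` (\<Sum>i\<in>I. A i) = (\<Sum>i\<in>I. f ` A i)"
  by (induction I rule: infinite_finite_induct) (simp_all add: linear_0[OF assms] linear_image_set_plus[OF assms])

lemma linear_image_dilate: "linear f \<Longrightarrow> f ` dilate t A = dilate t (f ` A)"
  by (simp add: dilate_def image_image linear_scale)

text \<open>\<open>reindex g\<close> is linear and preserves volumes of compact sets, so it carries
  Minkowski's expansion from one space to the other.\<close>

lemma is_mixed_volume_transfer:
  fixes g :: "'m::finite \<Rightarrow> 'n::finite"
  assumes g: "bij g" and V: "is_mixed_volume (V :: (real^'m) set list \<Rightarrow> real)"
  shows "is_mixed_volume (\<lambda>Ks :: (real^'n) set list. V (map ((`) (reindex g)) Ks))"
proof -
  have card: "CARD('m) = CARD('n)" using g by (rule bij_betw_same_card)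
  have lin: "linear (reindex g)" by (rule linear_reindex)
  have bodies: "reindex g ` K \<in> convex_bodies" if "K \<in> convex_bodies" for K
    using that lin by (auto simp: convex_bodies_def linear_conv_bounded_linear
        intro!: compact_continuous_image linear_continuous_on convex_linear_image)
  show ?thesis unfolding is_mixed_volume_def
  proof (intro conjI allI impI)
    fix Ks Ls :: "(real^'n) set list"
    assume "length Ks = CARD('n) \<and> set Ks \<subseteq> convex_bodies \<and> mset Ls = mset Ks"
    then have "length (map ((`) (reindex g)) Ks) = CARD('m) \<and> set (map ((`) (reindex g)) Ks) \<subseteq> convex_bodies \<and>
        mset (map ((`) (reindex g)) Ls) = mset (map ((`) (reindex g)) Ks)"
      using bodies by (auto simp: card)
    then show "V (map ((`) (reindex g)) Ls) = V (map ((`) (reindex g)) Ks)"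
      using V unfolding is_mixed_volume_def by blast
  next
    fix m :: nat and K :: "nat \<Rightarrow> (real^'n) set" and t :: "nat \<Rightarrow> real"
    assume K: "\<forall>i\<in>{1..m}. K i \<in> convex_bodies \<and> 0 \<le> t i"
    then have "compact (\<Sum>i\<in>{1..m}. dilate (t i) (K i))"
      by (intro compact_set_sum compact_dilate) (auto simp: convex_bodies_def)
    from vol_reindex[OF g this]
    have "vol (\<Sum>i\<in>{1..m}. dilate (t i) (K i)) = vol (\<Sum>i\<in>{1..m}. dilate (t i) (reindex g ` K i))"
      by (simp only: linear_image_set_sum[OF lin] linear_image_dilate[OF lin])
    also have "\<dots> = (\<Sum>is | set is \<subseteq> {1..m} \<and> length is = CARD('m).
        V (map (\<lambda>i. reindex g ` K i) is) * prod_list (map t is))"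
      using K bodies by (intro V[unfolded is_mixed_volume_def, THEN conjunct2, rule_format]) auto
    finally show "vol (\<Sum>i\<in>{1..m}. dilate (t i) (K i)) = (\<Sum>is | set is \<subseteq> {1..m} \<and> length is = CARD('n).
        V (map ((`) (reindex g)) (map K is)) * prod_list (map t is))"
      by (simp add: card o_def)
  qed
qed

text \<open>Existence of some mixed volume is what makes the choice in \<open>mixed_volume\<close>
  meaningful.\<close>

theorem minkowski_mixed_volume: "is_mixed_volume (mixed_volume :: (real^'n) set list \<Rightarrow> real)"
proof -
  obtain g :: "'n ordered_index \<Rightarrow> 'n" where "bij g"
    using finite_same_card_bij[of "UNIV::'n ordered_index set" "UNIV::'n set"] card_ordered_index by auto
  from is_mixed_volume_transfer[OF this is_mixed_volume_polarized_volume]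
  show ?thesis unfolding mixed_volume_def by (rule someI[of is_mixed_volume])
qed

section \<open>Polynomials in two variables\<close>

definition bipoly :: "nat \<Rightarrow> (nat \<Rightarrow> nat \<Rightarrow> real) \<Rightarrow> real \<Rightarrow> real \<Rightarrow> real" where
  "bipoly n c s t = (\<Sum>j\<le>n. \<Sum>k\<le>n. c j k * s ^ j * t ^ k)"

text \<open>A formal partial derivative. At \<open>j = 0\<close> the exponent \<open>j - 1\<close>
  truncates to 0, but the factor \<open>real j\<close> removes the term.\<close>

definition bipoly_ds :: "nat \<Rightarrow> (nat \<Rightarrow> nat \<Rightarrow> real) \<Rightarrow> real \<Rightarrow> real \<Rightarrow> real" where
  "bipoly_ds n c s t = (\<Sum>j\<le>n. \<Sum>k\<le>n. c j k * (real j * s ^ (j - 1)) * t ^ k)"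

definition bipoly_dt :: "nat \<Rightarrow> (nat \<Rightarrow> nat \<Rightarrow> real) \<Rightarrow> real \<Rightarrow> real \<Rightarrow> real" where
  "bipoly_dt n c s t = (\<Sum>j\<le>n. \<Sum>k\<le>n. c j k * s ^ j * (real k * t ^ (k - 1)))"

definition bipoly_dst :: "nat \<Rightarrow> (nat \<Rightarrow> nat \<Rightarrow> real) \<Rightarrow> real \<Rightarrow> real \<Rightarrow> real" where
  "bipoly_dst n c s t = (\<Sum>j\<le>n. \<Sum>k\<le>n. c j k * (real j * s ^ (j - 1)) * (real k * t ^ (k - 1)))"

lemma DERIV_bipoly_s: "((\<lambda>s. bipoly n c s t) has_real_derivative bipoly_ds n c s t) (at s)"
  unfolding bipoly_def bipoly_ds_def
  by (auto intro!: DERIV_sum derivative_eq_intros)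

lemma DERIV_bipoly_t: "((\<lambda>t. bipoly n c s t) has_real_derivative bipoly_dt n c s t) (at t)"
  unfolding bipoly_def bipoly_dt_def
  by (auto intro!: DERIV_sum derivative_eq_intros)

lemma DERIV_bipoly_ds_t: "((\<lambda>t. bipoly_ds n c s t) has_real_derivative bipoly_dst n c s t) (at t)"
  unfolding bipoly_ds_def bipoly_dst_def
  by (auto intro!: DERIV_sum derivative_eq_intros)

lemma real_mult_0_power_pred: "real j * 0 ^ (j - 1) = (if j = 1 then 1 else 0)"
  by (cases j) (auto simp: power_0_left)

lemma bipoly_at_0:
  assumes "n \<ge> 1"
  shows "bipoly n c 0 0 = c 0 0" "bipoly_ds n c 0 0 = c 1 0" "bipoly_dt n c 0 0 = c 0 1" "bipoly_dst n c 0 0 = c 1 1"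
proof -
  have d: "(\<Sum>k\<le>n. f k * (if k = 1 then 1 else 0)) = f 1" "(\<Sum>k\<le>n. f k * (if k = 0 then 1 else 0)) = f 0" for f :: "nat \<Rightarrow> real"
    using assms by (simp_all add: if_distrib[of "(*) _"] cong: if_cong)
  note defs = bipoly_def bipoly_ds_def bipoly_dt_def bipoly_dst_def
  show "bipoly n c 0 0 = c 0 0" "bipoly_ds n c 0 0 = c 1 0" "bipoly_dt n c 0 0 = c 0 1" "bipoly_dst n c 0 0 = c 1 1"
    unfolding defs real_mult_0_power_pred unfolding power_0_left by (simp_all only: d)
qed

text \<open>Volumes give polynomial identities for nonnegative arguments only; a two-sided
  derivative is already determined by the values on the right.\<close>

lemma DERIV_eq_if_eq_on_right:
  fixes f g :: "real \<Rightarrow> real"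
  assumes f: "(f has_real_derivative a) (at 0)" and g: "(g has_real_derivative b) (at 0)"
    and eq: "\<And>u. u \<ge> 0 \<Longrightarrow> f u = g u"
  shows "a = b"
proof -
  \<comment> \<open>Stated for arbitrary functions, so that it can be applied twice with the roles
    exchanged.\<close>
  have le: "a \<le> b" if f: "(f has_real_derivative a) (at 0)" and g: "(g has_real_derivative b) (at 0)"
    and eq: "\<And>u. u \<ge> 0 \<Longrightarrow> f u = g u" for f g :: "real \<Rightarrow> real" and a b
  proof (rule ccontr)
    assume "\<not> a \<le> b"
    then have "a - b > 0" by simp
    from DERIV_pos_inc_right[OF DERIV_diff[OF f g] this]
    obtain d where d: "d > 0" "\<forall>h>0. h < d \<longrightarrow> f 0 - g 0 < f (0 + h) - g (0 + h)" by blast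
    have "f 0 - g 0 < f (0 + d / 2) - g (0 + d / 2)" using d by simp
    then show False using eq[of 0] eq[of "d / 2"] d(1) by simp
  qed
  show ?thesis using le[OF f g eq] le[OF g f eq[symmetric]] by simp
qed

lemma DERIV_shifted_at_0:
  assumes "(f has_real_derivative y) (at s)"
  shows "((\<lambda>u. f (s + u)) has_real_derivative y) (at 0)"
  using assms DERIV_shift[of f y 0 s] by (simp add: add.commute)

text \<open>Moving the base point to \<open>(s, t)\<close> turns low-order coefficients into partial
  derivatives. This will express mixed volumes with base body \<open>A + sB + tC\<close> through one
  polynomial.\<close>

lemma bipoly_shift_derivatives:
  assumes n: "n \<ge> 1"
    and eq: "\<And>u v. u \<ge> 0 \<Longrightarrow> v \<ge> 0 \<Longrightarrow> bipoly n c' u v = bipoly n c (s + u) (t + v)"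
  shows "c' 0 0 = bipoly n c s t" "c' 1 0 = bipoly_ds n c s t"
    "c' 0 1 = bipoly_dt n c s t" "c' 1 1 = bipoly_dst n c s t"
proof -
  show "c' 0 0 = bipoly n c s t" using eq[of 0 0] by (simp add: bipoly_at_0[OF n])
  \<comment> \<open>Kept for all \<open>v \<ge> 0\<close>, so that the identity can be
    differentiated once more in the second variable.\<close>
  have ds: "bipoly_ds n c' 0 v = bipoly_ds n c s (t + v)" if "v \<ge> 0" for v
    using eq that by (intro DERIV_eq_if_eq_on_right[OF DERIV_bipoly_s DERIV_shifted_at_0[OF DERIV_bipoly_s]])
  from this[of 0] show "c' 1 0 = bipoly_ds n c s t" by (simp add: bipoly_at_0[OF n])
  have "bipoly_dt n c' 0 0 = bipoly_dt n c s t"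
    using eq[of 0] by (intro DERIV_eq_if_eq_on_right[OF DERIV_bipoly_t DERIV_shifted_at_0[OF DERIV_bipoly_t]]) simp
  then show "c' 0 1 = bipoly_dt n c s t" by (simp add: bipoly_at_0[OF n])
  have "bipoly_dst n c' 0 0 = bipoly_dst n c s t"
    using ds by (intro DERIV_eq_if_eq_on_right[OF DERIV_bipoly_ds_t DERIV_shifted_at_0[OF DERIV_bipoly_ds_t]])
  then show "c' 1 1 = bipoly_dst n c s t" by (simp add: bipoly_at_0[OF n])
qed

text \<open>The hypothesis says that \<open>log p\<close> has a nonpositive mixed second derivative.\<close>

lemma bipoly_product_le:
  assumes pos: "\<And>s t. 0 \<le> s \<Longrightarrow> 0 \<le> t \<Longrightarrow> bipoly n c s t > 0"
    and mixed: "\<And>s t. 0 \<le> s \<Longrightarrow> 0 \<le> t \<Longrightarrow>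
        bipoly n c s t * bipoly_dst n c s t \<le> bipoly_ds n c s t * bipoly_dt n c s t"
  shows "bipoly n c 0 0 * bipoly n c 1 1 \<le> bipoly n c 1 0 * bipoly n c 0 1"
proof -
  \<comment> \<open>The logarithmic derivative in \<open>s\<close> is nonincreasing in
    \<open>t\<close>, by \<open>mixed\<close>.\<close>
  have quot: "bipoly_ds n c s 1 / bipoly n c s 1 \<le> bipoly_ds n c s 0 / bipoly n c s 0" if s: "s \<ge> 0" for s
  proof (rule DERIV_nonpos_imp_nonincreasing[of 0 1 "\<lambda>t. bipoly_ds n c s t / bipoly n c s t"])
    fix t :: real assume t: "0 \<le> t"
    let ?y = "(bipoly_dst n c s t * bipoly n c s t - bipoly_ds n c s t * bipoly_dt n c s t) / (bipoly n c s t * bipoly n c s t)"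
    have "((\<lambda>t. bipoly_ds n c s t / bipoly n c s t) has_real_derivative ?y) (at t)"
      using pos[OF s t] by (intro DERIV_divide DERIV_bipoly_ds_t DERIV_bipoly_t) auto
    moreover have "?y \<le> 0"
      using mixed[OF s t] pos[OF s t] by (intro divide_nonpos_pos) (auto simp: mult.commute)
    ultimately show "\<exists>y. ((\<lambda>t. bipoly_ds n c s t / bipoly n c s t) has_real_derivative y) (at t) \<and> y \<le> 0" by blast
  qed simp
  have le: "bipoly_ds n c s 1 * bipoly n c s 0 \<le> bipoly n c s 1 * bipoly_ds n c s 0" if "s \<ge> 0" for s
    using quot[OF that] pos[OF that, of 0] pos[OF that, of 1] that by (simp add: field_simps)
  \<comment> \<open>By \<open>le\<close>, the quotient of the values at \<open>t = 1\<close> and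
    \<open>t = 0\<close> is nonincreasing in \<open>s\<close>; it is compared at
    \<open>s = 0\<close> and \<open>s = 1\<close>.\<close>
  have "bipoly n c 1 1 / bipoly n c 1 0 \<le> bipoly n c 0 1 / bipoly n c 0 0"
  proof (rule DERIV_nonpos_imp_nonincreasing[of 0 1 "\<lambda>s. bipoly n c s 1 / bipoly n c s 0"])
    fix s :: real assume s: "0 \<le> s"
    let ?y = "(bipoly_ds n c s 1 * bipoly n c s 0 - bipoly n c s 1 * bipoly_ds n c s 0) / (bipoly n c s 0 * bipoly n c s 0)"
    have "((\<lambda>s. bipoly n c s 1 / bipoly n c s 0) has_real_derivative ?y) (at s)"
      using pos[OF s, of 0] by (intro DERIV_divide DERIV_bipoly_s) auto
    moreover have "?y \<le> 0"
      using le[OF s] pos[OF s, of 0] by (intro divide_nonpos_pos) auto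
    ultimately show "\<exists>y. ((\<lambda>s. bipoly n c s 1 / bipoly n c s 0) has_real_derivative y) (at s) \<and> y \<le> 0" by blast
  qed simp
  then show ?thesis using pos[of 1 0] pos[of 0 0] by (simp add: field_simps)
qed

text \<open>On the diagonal the difference of the two sides of \<open>le\<close> is
  \<open>s\<^sup>2 * R s\<close>. Dividing by \<open>s\<^sup>2\<close> and letting \<open>s\<close>
  tend to 0 from the right gives \<open>R 0 \<le> 0\<close>, which is the claim.\<close>

lemma bipoly_coefficient_le:
  assumes n: "n \<ge> 1"
    and le: "\<And>s. s > 0 \<Longrightarrow> c 0 0 * bipoly n c s s \<le> bipoly n c s 0 * bipoly n c 0 s"
  shows "c 0 0 * c 1 1 \<le> c 1 0 * c 0 1"
proof -
  \<comment> \<open>The coefficient of \<open>s ^ j * t ^ k\<close> in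
    \<open>p(0,0) p(s,t) - p(s,0) p(0,t)\<close>. It vanishes for \<open>j = 0\<close> and for
    \<open>k = 0\<close>, whence the factor \<open>s\<^sup>2\<close>.\<close>
  define d where "d j k = c 0 0 * c j k - c j 0 * c 0 k" for j k
  define R where "R s = (\<Sum>j<n. \<Sum>k<n. d (Suc j) (Suc k) * s ^ (j + k))" for s :: real
  have s0: "bipoly n c s 0 = (\<Sum>j\<le>n. c j 0 * s ^ j)" "bipoly n c 0 s = (\<Sum>k\<le>n. c 0 k * s ^ k)" for s
    unfolding bipoly_def power_0_left
    by (simp add: if_distrib cong: if_cong, subst sum.swap, simp add: if_distrib if_distribR cong: if_cong)
  have "c 0 0 * bipoly n c s s - bipoly n c s 0 * bipoly n c 0 s = s\<^sup>2 * R s" for s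
  proof -
    have "c 0 0 * bipoly n c s s - bipoly n c s 0 * bipoly n c 0 s = (\<Sum>j\<le>n. \<Sum>k\<le>n. d j k * s ^ (j + k))"
      unfolding s0 unfolding sum_product bipoly_def d_def
      by (simp add: sum_distrib_left sum_subtractf[symmetric] power_add algebra_simps)
    also have "\<dots> = (\<Sum>j<n. \<Sum>k<n. d (Suc j) (Suc k) * s ^ (Suc j + Suc k))"
      unfolding lessThan_Suc_atMost[symmetric] sum.lessThan_Suc_shift
      by (simp add: d_def)
    also have "\<dots> = s\<^sup>2 * R s"
      by (simp add: R_def sum_distrib_left power2_eq_square algebra_simps)
    finally show ?thesis .
  qed
  then have "R s \<le> 0" if "s > 0" for s
    using le[OF that] that by (metis diff_le_0_iff_le mult_le_0_iff not_le zero_less_power)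
  moreover have "(R \<longlongrightarrow> R 0) (at_right 0)"
    unfolding R_def by (intro tendsto_intros)
  ultimately have "R 0 \<le> 0"
    by (intro tendsto_upperbound[of R "R 0" "at_right 0" 0]) (auto simp: eventually_at_right_less eventually_at_filter)
  moreover have "R 0 = d 1 1"
  proof -
    obtain m where m: "n = Suc m" using n by (cases n) auto
    show ?thesis unfolding R_def m by (simp add: sum.lessThan_Suc_shift del: sum.lessThan_Suc)
  qed
  ultimately show ?thesis by (simp add: d_def)
qed

section \<open>Coefficients of the volume polynomial\<close>

lemma mset_three_values:
  assumes "set xs \<subseteq> {a, b, c}" "a \<noteq> b" "a \<noteq> c" "b \<noteq> c"
  shows "mset xs = replicate_mset (count (mset xs) a) a + replicate_mset (count (mset xs) b) b + replicate_mset (count (mset xs) c) c"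
  using assms by (induction xs) (auto simp: replicate_mset_Suc)

lemma permutations_of_replicate_mset: "permutations_of_multiset (replicate_mset k x) = {replicate k x}"
proof -
  have "xs = replicate k x" if "mset xs = replicate_mset k x" for xs
  proof (rule replicate_eqI[symmetric, THEN sym])
    show "length xs = k" using arg_cong[OF that, of size] by simp
    show "y = x" if "y \<in> set xs" for y
      using that arg_cong[OF \<open>mset xs = replicate_mset k x\<close>, of set_mset] by (auto split: if_splits)
  qed
  then show ?thesis by (auto simp: permutations_of_multiset_def)
qed

lemma card_permutations_one_different:
  assumes "x \<noteq> y"
  shows "card (permutations_of_multiset (replicate_mset k x + {#y#})) = k + 1"
  using card_permutations_of_multiset_insert_aux[of "replicate_mset k x" y] assms
  by (simp add: permutations_of_replicate_mset)

lemma card_permutations_two_different: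
  assumes "x \<noteq> y" "x \<noteq> z" "y \<noteq> z"
  shows "card (permutations_of_multiset (replicate_mset k x + {#y#} + {#z#})) = (k + 2) * (k + 1)"
  using card_permutations_of_multiset_insert_aux[of "replicate_mset k x + {#y#}" z] assms
    card_permutations_one_different[OF assms(1), of k]
  by simp

text \<open>Minkowski's expansion with weights \<open>1, s, t\<close>, its index lists grouped by
  exponents. The factors \<open>n\<close> and \<open>n (n - 1)\<close> count the lists with one or
  two exceptional entries.\<close>

lemma volume_three_bodies:
  fixes A B C :: "(real^'n) set"
  assumes n: "CARD('n) \<ge> 2" and bodies: "A \<in> convex_bodies" "B \<in> convex_bodies" "C \<in> convex_bodies"
  obtains c where
    "\<And>s t. s \<ge> 0 \<Longrightarrow> t \<ge> 0 \<Longrightarrow> vol (A + dilate s B + dilate t C) = bipoly CARD('n) c s t"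
    "c 1 0 = real CARD('n) * mixed_volume (replicate (CARD('n) - 1) A @ [B])"
    "c 0 1 = real CARD('n) * mixed_volume (replicate (CARD('n) - 1) A @ [C])"
    "c 1 1 = real CARD('n) * (real CARD('n) - 1) * mixed_volume (replicate (CARD('n) - 2) A @ [B, C])"
proof -
  let ?n = "CARD('n)" and ?V = "mixed_volume :: (real^'n) set list \<Rightarrow> real"
  define K where "K i = (if i = 1 then A else if i = 2 then B else C)" for i :: nat
  define L where "L = {is::nat list. set is \<subseteq> {1..3} \<and> length is = ?n}"
  \<comment> \<open>Index 1 has weight 1, so the numbers of entries 2 and 3 are the exponents of
    \<open>s\<close> and \<open>t\<close>.\<close>
  define cnt where "cnt is = (count (mset is) 2, count (mset is) 3)" for "is" :: "nat list"
  define c where "c j k = (\<Sum>is | is \<in> L \<and> cnt is = (j, k). ?V (map K is))" for j k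
  have set3: "{1..3} = {1, 2, 3::nat}" by auto
  have L: "finite L" by (simp add: L_def finite_lists_length_eq)
  have V: "is_mixed_volume ?V" by (rule minkowski_mixed_volume)
  have cnt_le: "cnt ` L \<subseteq> {..?n} \<times> {..?n}"
    by (auto simp: cnt_def L_def count_mset) (metis count_le_length)+
  have expansion: "vol (A + dilate s B + dilate t C) = bipoly ?n c s t" if st: "s \<ge> 0" "t \<ge> 0" for s t
  proof -
    define w where "w i = (if i = 1 then 1 else if i = 2 then s else t)" for i :: nat
    have w: "prod_list (map w is) = s ^ fst (cnt is) * t ^ snd (cnt is)" if "set is \<subseteq> {1..3}" for "is"
      using that by (induction "is") (auto simp: w_def cnt_def set3)
    have "vol (A + dilate s B + dilate t C) = vol (\<Sum>i\<in>{1..3}. dilate (w i) (K i))"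
      unfolding set3 by (simp add: w_def K_def add.assoc)
    also have "\<dots> = (\<Sum>is\<in>L. ?V (map K is) * prod_list (map w is))"
      unfolding L_def using st bodies
      by (intro V[unfolded is_mixed_volume_def, THEN conjunct2, rule_format]) (auto simp: K_def w_def)
    also have "\<dots> = (\<Sum>is\<in>L. ?V (map K is) * s ^ fst (cnt is) * t ^ snd (cnt is))"
      by (intro sum.cong refl) (simp add: w L_def)
    also have "\<dots> = (\<Sum>p\<in>{..?n} \<times> {..?n}. \<Sum>is | is \<in> L \<and> cnt is = p. ?V (map K is) * s ^ fst (cnt is) * t ^ snd (cnt is))"
      by (rule sum.group[symmetric, OF L _ cnt_le]) simp
    also have "\<dots> = (\<Sum>p\<in>{..?n} \<times> {..?n}. c (fst p) (snd p) * s ^ fst p * t ^ snd p)"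
      unfolding c_def sum_distrib_right by (intro sum.cong refl) auto
    finally show ?thesis by (simp add: bipoly_def sum.cartesian_product case_prod_unfold)
  qed
  \<comment> \<open>Lists with equal counts rearrange one multiset and, by symmetry, have equal
    mixed volumes.\<close>
  have coeff: "c j k = real (card (permutations_of_multiset M)) * ?V Ks"
    if M: "M = replicate_mset (?n - j - k) 1 + replicate_mset j 2 + replicate_mset k 3" and jk: "j + k \<le> ?n"
      and Ks: "mset Ks = replicate_mset (?n - j - k) A + replicate_mset j B + replicate_mset k C" for j k Ks and M :: "nat multiset"
  proof -
    have "{is \<in> L. cnt is = (j, k)} = permutations_of_multiset M"
    proof (intro equalityI subsetI)
      fix "is" assume iL: "is \<in> {is \<in> L. cnt is = (j, k)}"
      then have "set is \<subseteq> {1, 2, 3}" unfolding L_def set3 by blast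
      with mset_three_values[of "is" 1 2 3] iL
      have m: "mset is = replicate_mset (count (mset is) 1) 1 + replicate_mset j 2 + replicate_mset k 3"
        by (simp add: cnt_def)
      from arg_cong[OF m, of size] have "length is = count (mset is) 1 + j + k" by simp
      moreover have "length is = ?n" using iL by (simp add: L_def)
      ultimately have "count (mset is) 1 = ?n - j - k" by linarith
      then show "is \<in> permutations_of_multiset M" using m M by (simp add: permutations_of_multiset_def)
    next
      fix "is" assume "is \<in> permutations_of_multiset M"
      then have m: "mset is = M" by (simp add: permutations_of_multiset_def)
      have "length is = ?n" using arg_cong[OF m, of size] M jk by simp
      moreover have "set is \<subseteq> {1..3}"
        using arg_cong[OF m, of set_mset] M by (auto split: if_splits)
      moreover have "cnt is = (j, k)" by (simp add: cnt_def m M)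
      ultimately show "is \<in> {is \<in> L. cnt is = (j, k)}" by (simp add: L_def)
    qed
    moreover have "?V (map K is) = ?V Ks" if "mset is = M" for "is"
    proof -
      have "length Ks = ?n" using arg_cong[OF Ks, of size] jk by simp
      moreover have "set Ks \<subseteq> convex_bodies"
        using arg_cong[OF Ks, of set_mset] bodies by (auto split: if_splits)
      moreover have "mset (map K is) = mset Ks"
        by (simp add: that M Ks K_def)
      ultimately show ?thesis using V unfolding is_mixed_volume_def by blast
    qed
    ultimately show ?thesis by (simp add: c_def permutations_of_multiset_def)
  qed
  have "c 1 0 = real ?n * ?V (replicate (?n - 1) A @ [B])"
    using n coeff[of "replicate_mset (?n - 1) 1 + {#2#}" 1 0] card_permutations_one_different[of "1::nat" 2 "?n - 1"] by simp
  moreover have "c 0 1 = real ?n * ?V (replicate (?n - 1) A @ [C])"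
    using n coeff[of "replicate_mset (?n - 1) 1 + {#3#}" 0 1] card_permutations_one_different[of "1::nat" 3 "?n - 1"] by simp
  moreover have "c 1 1 = real ?n * (real ?n - 1) * ?V (replicate (?n - 2) A @ [B, C])"
  proof -
    have "real ((?n - 2 + 2) * (?n - 2 + 1)) = real ?n * (real ?n - 1)"
    proof -
      have "?n - 2 + 2 = ?n" "?n - 2 + 1 = ?n - 1" using n by auto
      then have "real ((?n - 2 + 2) * (?n - 2 + 1)) = real (?n * (?n - 1))" by (simp only:)
      then show ?thesis using n by (simp add: of_nat_diff)
    qed
    then show ?thesis
      using n coeff[of "replicate_mset (?n - 2) 1 + {#2#} + {#3#}" 1 1 "replicate (?n - 2) A @ [B, C]"]
        card_permutations_two_different[of "1::nat" 2 3 "?n - 2"]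
      by (simp add: numeral_2_eq_2 del: of_nat_mult of_nat_add of_nat_Suc)
  qed
  ultimately show ?thesis using that expansion by blast
qed

section \<open>The five inequalities\<close>

text \<open>\<open>A + B\<close> contains a translate of \<open>A\<close>.\<close>

lemma vol_le_vol_set_plus:
  fixes A B :: "(real^'n) set"
  assumes "compact A" "compact B" "B \<noteq> {}"
  shows "vol A \<le> vol (A + B)"
proof -
  obtain b where "b \<in> B" using assms by blast
  then have "(+) b ` A \<subseteq> A + B" by (auto simp: set_plus_def add.commute)
  then have "vol ((+) b ` A) \<le> vol (A + B)"
    using assms by (intro measure_mono_fmeasurable fmeasurableD lmeasurable_compact compact_set_plus compact_translation)
  then show ?thesis by (simp only: measure_translation)
qed

text \<open>Convexity gives the inclusion from right to left, through the weights
  \<open>s / (s + t)\<close> and \<open>t / (s + t)\<close>.\<close>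

lemma dilate_add_convex:
  assumes "convex K" "s \<ge> 0" "t \<ge> 0"
  shows "dilate (s + t) K = dilate s K + dilate t K"
proof (cases "s = 0 \<and> t = 0 \<or> K = {}")
  case True
  then show ?thesis by (cases "K = {}") (auto simp: dilate_def set_plus_def)
next
  case False
  then have "s + t > 0" using assms by auto
  show ?thesis
  proof (intro equalityI subsetI)
    fix x assume "x \<in> dilate (s + t) K"
    then show "x \<in> dilate s K + dilate t K"
      by (auto simp: dilate_def scaleR_add_left)
  next
    fix x assume "x \<in> dilate s K + dilate t K"
    then obtain a b where ab: "a \<in> K" "b \<in> K" "x = s *\<^sub>R a + t *\<^sub>R b"
      by (auto simp: dilate_def set_plus_def)
    have "(s / (s + t)) *\<^sub>R a + (t / (s + t)) *\<^sub>R b \<in> K"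
      using assms ab \<open>s + t > 0\<close> by (intro convexD) (auto simp: add_divide_distrib[symmetric])
    moreover have "x = (s + t) *\<^sub>R ((s / (s + t)) *\<^sub>R a + (t / (s + t)) *\<^sub>R b)"
      using \<open>s + t > 0\<close> by (simp add: ab scaleR_add_right)
    ultimately show "x \<in> dilate (s + t) K" by (auto simp: dilate_def)
  qed
qed

text \<open>No summand is \<open>\<infinity>\<close>, so a sum is \<open>-\<infinity>\<close>
  exactly when the corresponding product is zero.\<close>

lemma log_ext_add_le_iff:
  assumes "a \<ge> 0" "b \<ge> 0" "c \<ge> 0" "d \<ge> 0"
  shows "log_ext a + log_ext b \<le> log_ext c + log_ext d \<longleftrightarrow> a * b \<le> c * d"
proof (cases "a = 0 \<or> b = 0")
  case True
  then show ?thesis using assms by (auto simp: log_ext_def)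
next
  case False
  then have ab: "a > 0" "b > 0" using assms by auto
  then have "a * b > 0" by simp
  show ?thesis
  proof (cases "c = 0 \<or> d = 0")
    case True
    with ab \<open>a * b > 0\<close> show ?thesis by (auto simp: log_ext_def mult_le_0_iff)
  next
    case False
    then have "c > 0" "d > 0" using assms by auto
    moreover from this ab have "ln a + ln b = ln (a * b)" "ln c + ln d = ln (c * d)"
      by (simp_all add: ln_mult)
    ultimately show ?thesis using ab by (simp add: log_ext_def)
  qed
qed

context
  fixes \<K> :: "(real^'n) set set"
  assumes dim: "CARD('n) \<ge> 2"
    and bodies: "\<K> \<subseteq> convex_bodies"
    and stable: "stable_under_sums_and_dilation \<K>"
begin

text \<open>Statement 1 for \<open>m = 2\<close> without indices. Statements 1, 2, 4 and 5 are each
  compared with it; statement 3 is reduced to statement 2.\<close>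

definition volume_log_submodular where
  "volume_log_submodular \<longleftrightarrow>
    (\<forall>A\<in>\<K>. \<forall>B\<in>\<K>. \<forall>C\<in>\<K>. vol A * vol (A + B + C) \<le> vol (A + B) * vol (A + C))"

lemma class_add: "A \<in> \<K> \<Longrightarrow> B \<in> \<K> \<Longrightarrow> A + B \<in> \<K>"
  and class_dilate: "A \<in> \<K> \<Longrightarrow> t > 0 \<Longrightarrow> dilate t A \<in> \<K>"
  using stable by (auto simp: stable_under_sums_and_dilation_def)

lemma class_convex_bodies: "A \<in> \<K> \<Longrightarrow> A \<in> convex_bodies"
  using bodies by blast

lemma class_compact: "A \<in> \<K> \<Longrightarrow> compact A"
  and class_convex: "A \<in> \<K> \<Longrightarrow> convex A"
  and class_nonempty: "A \<in> \<K> \<Longrightarrow> A \<noteq> {}"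
  using bodies by (auto simp: convex_bodies_def)

text \<open>Stability concerns positive factors; for \<open>t = 0\<close> the second summand is
  \<open>{0}\<close>, since \<open>B\<close> is nonempty.\<close>

lemma class_add_dilate: "A \<in> \<K> \<Longrightarrow> B \<in> \<K> \<Longrightarrow> t \<ge> 0 \<Longrightarrow> A + dilate t B \<in> \<K>"
  by (cases "t > 0") (auto simp: class_nonempty intro: class_add class_dilate)

lemma class_sum:
  assumes "finite S" "S \<noteq> {}" "\<And>i. i \<in> S \<Longrightarrow> B i \<in> \<K>"
  shows "(\<Sum>i\<in>S. B i) \<in> \<K>"
  using assms by (induction S rule: finite_ne_induct) (auto intro: class_add)

lemma class_add_sum:
  assumes "finite S" "A \<in> \<K>" "\<And>i. i \<in> S \<Longrightarrow> B i \<in> \<K>"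
  shows "A + (\<Sum>i\<in>S. B i) \<in> \<K>"
  using assms by (cases "S = {}") (auto intro: class_add class_sum)

section \<open>Statement 5 and the three-body volume inequality\<close>

lemma mixed_volume_inequality_of_volume_inequality:
  assumes K: "A \<in> \<K>" "B \<in> \<K>" "C \<in> \<K>" and Q: volume_log_submodular
  shows "vol A * mixed_volume (replicate (CARD('n) - 2) A @ [B, C]) \<le>
    real CARD('n) / (real CARD('n) - 1) * mixed_volume (replicate (CARD('n) - 1) A @ [B]) *
      mixed_volume (replicate (CARD('n) - 1) A @ [C])"
proof -
  let ?n = "real CARD('n)"
  obtain c where c:
    "\<And>s t. s \<ge> 0 \<Longrightarrow> t \<ge> 0 \<Longrightarrow> vol (A + dilate s B + dilate t C) = bipoly CARD('n) c s t"
    "c 1 0 = ?n * mixed_volume (replicate (CARD('n) - 1) A @ [B])"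
    "c 0 1 = ?n * mixed_volume (replicate (CARD('n) - 1) A @ [C])"
    "c 1 1 = ?n * (?n - 1) * mixed_volume (replicate (CARD('n) - 2) A @ [B, C])"
    by (rule volume_three_bodies[OF dim K[THEN class_convex_bodies]]) (rule that)
  have n: "CARD('n) \<ge> 1" "?n > 1" using dim by auto
  have B0: "dilate 0 B = {0}" "dilate 0 C = {0}" using K class_nonempty by auto
  have c00: "c 0 0 = vol A" using c(1)[of 0 0] by (simp add: B0 bipoly_at_0[OF n(1)])
  have "c 0 0 * c 1 1 \<le> c 1 0 * c 0 1"
  proof (rule bipoly_coefficient_le[OF n(1)])
    fix s :: real assume s: "s > 0"
    have "vol A * vol (A + dilate s B + dilate s C) \<le> vol (A + dilate s B) * vol (A + dilate s C)"
      using Q K s class_dilate unfolding volume_log_submodular_def by blast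
    then show "c 0 0 * bipoly CARD('n) c s s \<le> bipoly CARD('n) c s 0 * bipoly CARD('n) c 0 s"
      using s c(1)[of s s] c(1)[of s 0] c(1)[of 0 s] by (simp add: B0 c00)
  qed
  then have "?n * (?n - 1) * (vol A * mixed_volume (replicate (CARD('n) - 2) A @ [B, C])) \<le>
      ?n * (?n - 1) * (?n / (?n - 1) * mixed_volume (replicate (CARD('n) - 1) A @ [B]) *
      mixed_volume (replicate (CARD('n) - 1) A @ [C]))"
    using n(2) unfolding c00 c(2-4) by (simp add: mult_ac)
  then show ?thesis using n(2) by (subst (asm) mult_le_cancel_left_pos) auto
qed

text \<open>Statement 5 with base body \<open>A + sB + tC\<close> is a differential inequality for
  the volume polynomial at \<open>(s, t)\<close>, to which \<open>bipoly_product_le\<close>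
  applies.\<close>

lemma volume_inequality_of_mixed_volume_inequality:
  assumes P5: "\<And>A B C. A \<in> \<K> \<Longrightarrow> B \<in> \<K> \<Longrightarrow> C \<in> \<K> \<Longrightarrow>
    vol A * mixed_volume (replicate (CARD('n) - 2) A @ [B, C]) \<le>
    real CARD('n) / (real CARD('n) - 1) * mixed_volume (replicate (CARD('n) - 1) A @ [B]) *
      mixed_volume (replicate (CARD('n) - 1) A @ [C])"
  shows volume_log_submodular
  unfolding volume_log_submodular_def
proof (intro ballI)
  fix A B C assume K: "A \<in> \<K>" "B \<in> \<K>" "C \<in> \<K>"
  let ?n = "real CARD('n)"
  have n: "CARD('n) \<ge> 1" "?n > 1" using dim by auto
  show "vol A * vol (A + B + C) \<le> vol (A + B) * vol (A + C)"
  \<comment> \<open>If \<open>vol A = 0\<close>, the left side vanishes. Otherwise monotonicity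
    keeps the polynomial positive on the quadrant.\<close>
  proof (cases "vol A = 0")
    case True
    then show ?thesis by simp
  next
    case False
    then have A: "vol A > 0" by (simp add: zero_less_measure_iff)
    obtain c where c: "\<And>s t. s \<ge> 0 \<Longrightarrow> t \<ge> 0 \<Longrightarrow> vol (A + dilate s B + dilate t C) = bipoly CARD('n) c s t"
      by (rule volume_three_bodies[OF dim K[THEN class_convex_bodies]]) (rule that)
    have "bipoly CARD('n) c 0 0 * bipoly CARD('n) c 1 1 \<le> bipoly CARD('n) c 1 0 * bipoly CARD('n) c 0 1"
    proof (rule bipoly_product_le)
      fix s t :: real assume st: "0 \<le> s" "0 \<le> t"
      have "vol A \<le> vol (A + (dilate s B + dilate t C))"
        using K class_nonempty[OF K(2)] class_nonempty[OF K(3)]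
        by (intro vol_le_vol_set_plus compact_set_plus compact_dilate class_compact)
          (simp_all add: dilate_def set_plus_image)
      then show "bipoly CARD('n) c s t > 0" using A c[OF st] by (simp add: add.assoc)
      let ?A = "A + dilate s B + dilate t C"
      have A': "?A \<in> \<K>" using K st by (intro class_add_dilate)
      obtain c' where c':
        "\<And>u v. u \<ge> 0 \<Longrightarrow> v \<ge> 0 \<Longrightarrow> vol (?A + dilate u B + dilate v C) = bipoly CARD('n) c' u v"
        "c' 1 0 = ?n * mixed_volume (replicate (CARD('n) - 1) ?A @ [B])"
        "c' 0 1 = ?n * mixed_volume (replicate (CARD('n) - 1) ?A @ [C])"
        "c' 1 1 = ?n * (?n - 1) * mixed_volume (replicate (CARD('n) - 2) ?A @ [B, C])"
        by (rule volume_three_bodies[OF dim A'[THEN class_convex_bodies] K(2,3)[THEN class_convex_bodies]])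
          (rule that)
      \<comment> \<open>Convexity of \<open>B\<close> and \<open>C\<close> merges their successive
        dilates.\<close>
      have shift: "bipoly CARD('n) c' u v = bipoly CARD('n) c (s + u) (t + v)" if uv: "u \<ge> 0" "v \<ge> 0" for u v
      proof -
        have "?A + dilate u B + dilate v C = A + dilate (s + u) B + dilate (t + v) C"
          using K st uv by (simp add: dilate_add_convex class_convex ac_simps)
        then show ?thesis using c'(1)[OF uv] c[of "s + u" "t + v"] st uv by simp
      qed
      have derivs: "c' 0 0 = bipoly CARD('n) c s t" "c' 1 0 = bipoly_ds CARD('n) c s t"
        "c' 0 1 = bipoly_dt CARD('n) c s t" "c' 1 1 = bipoly_dst CARD('n) c s t"
        by (rule bipoly_shift_derivatives[OF n(1) shift]; assumption)+
      have c'00: "c' 0 0 = vol ?A" using derivs(1) c[OF st] by simp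
      have "vol ?A * mixed_volume (replicate (CARD('n) - 2) ?A @ [B, C]) \<le>
          ?n / (?n - 1) * mixed_volume (replicate (CARD('n) - 1) ?A @ [B]) * mixed_volume (replicate (CARD('n) - 1) ?A @ [C])"
        by (rule P5[OF A' K(2,3)])
      then have "?n * (?n - 1) * (vol ?A * mixed_volume (replicate (CARD('n) - 2) ?A @ [B, C])) \<le>
          ?n * (?n - 1) * (?n / (?n - 1) * mixed_volume (replicate (CARD('n) - 1) ?A @ [B]) *
          mixed_volume (replicate (CARD('n) - 1) ?A @ [C]))"
        using n(2) by (intro mult_left_mono) auto
      then have "c' 0 0 * c' 1 1 \<le> c' 1 0 * c' 0 1"
        using n(2) unfolding c'00 c'(2-4) by (simp add: mult_ac)
      then show "bipoly CARD('n) c s t * bipoly_dst CARD('n) c s t \<le> bipoly_ds CARD('n) c s t * bipoly_dt CARD('n) c s t"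
        by (simp only: derivs)
    qed
    then show ?thesis
      using c[of 0 0] c[of 1 1] c[of 1 0] c[of 0 1] K by (simp add: class_nonempty)
  qed
qed

section \<open>Statements 1, 2 and 4 and the three-body volume inequality\<close>

text \<open>An empty Minkowski sum is \<open>{0}\<close>, which need not belong to
  \<open>\<K>\<close>; that case is an equality and is treated separately.\<close>

lemma volume_log_submodularD:
  assumes Q: volume_log_submodular and fin: "finite S" "finite T"
    and A: "A \<in> \<K>" and B: "\<And>i. i \<in> S \<Longrightarrow> B i \<in> \<K>" and C: "\<And>i. i \<in> T \<Longrightarrow> C i \<in> \<K>"
  shows "vol (A + sum B S + sum C T) * vol A \<le> vol (A + sum B S) * vol (A + sum C T)"
proof (cases "S = {} \<or> T = {}")
  case True
  then show ?thesis by (auto simp: mult.commute)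
next
  case False
  then have "sum B S \<in> \<K>" "sum C T \<in> \<K>" using fin B C by (auto intro!: class_sum)
  then show ?thesis using Q A unfolding volume_log_submodular_def by (simp add: mult.commute)
qed

text \<open>The sum over \<open>S \<inter> T\<close> is absorbed into \<open>A\<close>; the sums
  over \<open>S - T\<close> and \<open>T - S\<close> are the two remaining bodies.\<close>

lemma set_function_submodular:
  assumes Q: volume_log_submodular and A: "A \<in> \<K>" and B: "B \<in> {1..m} \<rightarrow> \<K>"
  shows "submodular_set_fun m (\<lambda>S. log_ext (vol (A + (\<Sum>i\<in>S. B i))))"
  unfolding submodular_set_fun_def
proof (intro allI impI)
  fix S T assume "S \<subseteq> {1..m} \<and> T \<subseteq> {1..m}"
  then have ST: "S \<subseteq> {1..m}" "T \<subseteq> {1..m}" and fin: "finite S" "finite T" by (auto intro: finite_subset)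
  let ?A = "A + sum B (S \<inter> T)"
  have S: "sum B S = sum B (S \<inter> T) + sum B (S - T)"
    using fin by (metis add.commute inf_commute sum.Int_Diff)
  have T: "sum B T = sum B (S \<inter> T) + sum B (T - S)"
    using fin by (metis add.commute inf_commute sum.Int_Diff)
  have "S \<union> T = S \<union> (T - S)" by blast
  then have U: "sum B (S \<union> T) = sum B (S \<inter> T) + sum B (S - T) + sum B (T - S)"
    using fin S by (metis Diff_disjoint finite_Diff sum.union_disjoint)
  have "vol (?A + sum B (S - T) + sum B (T - S)) * vol ?A \<le> vol (?A + sum B (S - T)) * vol (?A + sum B (T - S))"
    using B ST fin by (intro volume_log_submodularD Q class_add_sum A) auto
  then show "log_ext (vol (A + sum B (S \<union> T))) + log_ext (vol (A + sum B (S \<inter> T)))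
      \<le> log_ext (vol (A + sum B S)) + log_ext (vol (A + sum B T))"
    by (simp add: log_ext_add_le_iff S T U add.assoc)
qed

lemma volume_inequality_of_set_function_submodular:
  assumes "\<And>A B. A \<in> \<K> \<Longrightarrow> B \<in> {1..2} \<rightarrow> \<K> \<Longrightarrow> submodular_set_fun 2 (\<lambda>S. log_ext (vol (A + (\<Sum>i\<in>S. B i))))"
  shows volume_log_submodular
  unfolding volume_log_submodular_def
proof (intro ballI)
  fix A B C assume K: "A \<in> \<K>" "B \<in> \<K>" "C \<in> \<K>"
  let ?B = "\<lambda>i::nat. if i = 1 then B else C"
  have "submodular_set_fun 2 (\<lambda>S. log_ext (vol (A + sum ?B S)))" using K by (intro assms) auto
  from this[unfolded submodular_set_fun_def, rule_format, of "{1}" "{2}"]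
  show "vol A * vol (A + B + C) \<le> vol (A + B) * vol (A + C)"
    by (simp add: log_ext_add_le_iff ac_simps)
qed

text \<open>Induction on \<open>m\<close>: the three-body inequality, applied to the sum of the
  first \<open>m\<close> bodies and to the next one, detaches the latter.\<close>

lemma product_inequality:
  assumes Q: volume_log_submodular and m: "m \<ge> 1" and A: "A \<in> \<K>" and B: "B \<in> {1..m} \<rightarrow> \<K>"
  shows "vol A ^ (m - 1) * vol (A + (\<Sum>i\<in>{1..m}. B i)) \<le> (\<Prod>i\<in>{1..m}. vol (A + B i))"
  using m B
proof (induction m rule: nat_induct_at_least)
  case base
  then show ?case by simp
next
  case (Suc m)
  have "vol (A + sum B {1..m} + sum B {Suc m}) * vol A \<le> vol (A + sum B {1..m}) * vol (A + sum B {Suc m})"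
    using Suc.prems by (intro volume_log_submodularD Q A) auto
  then have step: "vol A * vol (A + sum B {1..Suc m}) \<le> vol (A + sum B {1..m}) * vol (A + B (Suc m))"
    by (simp add: ac_simps)
  have "vol A ^ (Suc m - 1) * vol (A + sum B {1..Suc m}) = vol A ^ (m - 1) * (vol A * vol (A + sum B {1..Suc m}))"
    using Suc.hyps by (cases m) (auto simp: mult_ac)
  also have "\<dots> \<le> vol A ^ (m - 1) * (vol (A + sum B {1..m}) * vol (A + B (Suc m)))"
    by (intro mult_left_mono step) simp
  also have "\<dots> = (vol A ^ (m - 1) * vol (A + sum B {1..m})) * vol (A + B (Suc m))" by simp
  also have "\<dots> \<le> (\<Prod>i\<in>{1..m}. vol (A + B i)) * vol (A + B (Suc m))"
    using Suc.prems by (intro mult_right_mono Suc.IH) auto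
  finally show ?case by simp
qed

text \<open>The part with weights \<open>min (x i) (y i)\<close> is absorbed into \<open>A\<close>.
  The excesses of \<open>x\<close> and of \<open>y\<close> live on disjoint index sets, and the
  maximum adds both.\<close>

lemma function_submodular:
  assumes Q: volume_log_submodular and A: "A \<in> \<K>" and B: "B \<in> {1..m} \<rightarrow> \<K>"
  shows "submodular_fun m (\<lambda>x. log_ext (vol (A + (\<Sum>i\<in>{1..m}. dilate (x i) (B i)))))"
  unfolding submodular_fun_def
proof (intro ballI)
  fix x y assume "x \<in> orthant m" "y \<in> orthant m"
  then have xy: "x i \<ge> 0" "y i \<ge> 0" if "i \<in> {1..m}" for i using that by (auto simp: orthant_def PiE_iff)
  define S where "S = {i\<in>{1..m}. x i > y i}"
  define T where "T = {i\<in>{1..m}. y i > x i}"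
  define z where "z i = min (x i) (y i)" for i
  let ?I = "{1..m}" and ?A = "A + (\<Sum>i\<in>{1..m}. dilate (z i) (B i))"
  have B': "B i \<in> \<K>" if "i \<in> ?I" for i using B that by auto
  have z: "z i \<ge> 0" if "i \<in> ?I" for i using xy[OF that] by (simp add: z_def)
  \<comment> \<open>\<open>u\<close> exceeds \<open>z\<close> only on \<open>W\<close>, and there
    convexity splits each dilate into the common part and the excess.\<close>
  have decomp: "(\<Sum>i\<in>?I. dilate (u i) (B i)) = (\<Sum>i\<in>?I. dilate (z i) (B i)) + (\<Sum>i\<in>W. dilate (u i - z i) (B i))"
    if W: "W \<subseteq> ?I" and u: "\<And>i. i \<in> W \<Longrightarrow> u i \<ge> z i" "\<And>i. i \<in> ?I - W \<Longrightarrow> u i = z i" for u W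
  proof -
    have "(\<Sum>i\<in>W. dilate (u i - z i) (B i)) = (\<Sum>i\<in>?I. dilate (u i - z i) (B i))"
      using W u(2) B' by (intro sum.mono_neutral_left) (auto simp: class_nonempty)
    moreover have "dilate (u i) (B i) = dilate (z i) (B i) + dilate (u i - z i) (B i)" if "i \<in> ?I" for i
      using dilate_add_convex[of "B i" "z i" "u i - z i"] u z[OF that] class_convex[OF B'[OF that]] that
      by (cases "i \<in> W") auto
    ultimately show ?thesis by (simp add: sum.distrib[symmetric])
  qed
  define P where "P W u = (\<Sum>i\<in>W. dilate (u i - z i) (B i))" for W u
  have x: "(\<Sum>i\<in>?I. dilate (x i) (B i)) = (\<Sum>i\<in>?I. dilate (z i) (B i)) + P S x"
    unfolding P_def by (rule decomp) (auto simp: S_def z_def)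
  have y: "(\<Sum>i\<in>?I. dilate (y i) (B i)) = (\<Sum>i\<in>?I. dilate (z i) (B i)) + P T y"
    unfolding P_def by (rule decomp) (auto simp: T_def z_def)
  have "(\<Sum>i\<in>?I. dilate (max (x i) (y i)) (B i)) =
      (\<Sum>i\<in>?I. dilate (z i) (B i)) + (\<Sum>i\<in>S \<union> T. dilate (max (x i) (y i) - z i) (B i))"
    by (rule decomp) (auto simp: S_def T_def z_def)
  also have "(\<Sum>i\<in>S \<union> T. dilate (max (x i) (y i) - z i) (B i)) =
      (\<Sum>i\<in>S. dilate (max (x i) (y i) - z i) (B i)) + (\<Sum>i\<in>T. dilate (max (x i) (y i) - z i) (B i))"
    by (rule sum.union_disjoint) (auto simp: S_def T_def)
  also have "\<dots> = P S x + P T y"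
    unfolding P_def by (intro arg_cong2[where f="(+)"] sum.cong refl) (auto simp: S_def T_def)
  finally have xy_max: "(\<Sum>i\<in>?I. dilate (max (x i) (y i)) (B i)) = (\<Sum>i\<in>?I. dilate (z i) (B i)) + (P S x + P T y)" .
  \<comment> \<open>Indices with \<open>z i = 0\<close> contribute \<open>{0}\<close> and are
    dropped, so that only positive dilates enter the class.\<close>
  have A': "?A \<in> \<K>"
  proof -
    have "(\<Sum>i\<in>?I. dilate (z i) (B i)) = (\<Sum>i\<in>{i\<in>?I. z i > 0}. dilate (z i) (B i))"
      using z B' by (intro sum.mono_neutral_right) (auto simp: class_nonempty order_less_le)
    moreover have "A + (\<Sum>i\<in>{i\<in>?I. z i > 0}. dilate (z i) (B i)) \<in> \<K>"
      using A B' by (intro class_add_sum) (auto intro: class_dilate)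
    ultimately show ?thesis by simp
  qed
  have "vol (?A + P S x + P T y) * vol ?A \<le> vol (?A + P S x) * vol (?A + P T y)"
    unfolding P_def using B'
    by (intro volume_log_submodularD Q A') (auto simp: S_def T_def z_def intro!: class_dilate)
  then show "log_ext (vol (A + (\<Sum>i\<in>?I. dilate (max (x i) (y i)) (B i)))) +
      log_ext (vol (A + (\<Sum>i\<in>?I. dilate (min (x i) (y i)) (B i))))
      \<le> log_ext (vol (A + (\<Sum>i\<in>?I. dilate (x i) (B i)))) + log_ext (vol (A + (\<Sum>i\<in>?I. dilate (y i) (B i))))"
    unfolding xy_max x y z_def[symmetric] by (simp add: log_ext_add_le_iff add.assoc)
qed

lemma volume_inequality_of_function_submodular:
  assumes "\<And>A B. A \<in> \<K> \<Longrightarrow> B \<in> {1..2} \<rightarrow> \<K> \<Longrightarrow>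
      submodular_fun 2 (\<lambda>x. log_ext (vol (A + (\<Sum>i\<in>{1..2}. dilate (x i) (B i)))))"
  shows volume_log_submodular
  unfolding volume_log_submodular_def
proof (intro ballI)
  fix A B C assume K: "A \<in> \<K>" "B \<in> \<K>" "C \<in> \<K>"
  let ?B = "\<lambda>i::nat. if i = 1 then B else C"
  \<comment> \<open>The two unit vectors; their maximum is \<open>(1, 1)\<close> and their minimum
    \<open>(0, 0)\<close>. The restriction makes them \<open>undefined\<close> off
    \<open>{1..2}\<close>, as \<open>orthant\<close> demands.\<close>
  define x where "x j = (\<lambda>i\<in>{1..2}. if i = j then 1 else 0 :: real)" for j :: nat
  have "submodular_fun 2 (\<lambda>x. log_ext (vol (A + (\<Sum>i\<in>{1..2}. dilate (x i) (?B i)))))" using K by (intro assms) auto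
  moreover have "x j \<in> orthant 2" for j by (auto simp: x_def orthant_def)
  ultimately have "log_ext (vol (A + (\<Sum>i\<in>{1..2}. dilate (max (x 1 i) (x 2 i)) (?B i)))) +
      log_ext (vol (A + (\<Sum>i\<in>{1..2}. dilate (min (x 1 i) (x 2 i)) (?B i))))
      \<le> log_ext (vol (A + (\<Sum>i\<in>{1..2}. dilate (x 1 i) (?B i)))) + log_ext (vol (A + (\<Sum>i\<in>{1..2}. dilate (x 2 i) (?B i))))"
    unfolding submodular_fun_def by blast
  moreover have "{1..2} = {1, 2::nat}" by auto
  ultimately show "vol A * vol (A + B + C) \<le> vol (A + B) * vol (A + C)"
    using K by (simp add: x_def log_ext_add_le_iff add.assoc mult.commute class_nonempty)
qed

lemma product_inequality_iff:
  "(\<forall>m\<ge>1. \<forall>A\<in>\<K>. \<forall>B\<in>{1..m} \<rightarrow> \<K>.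
      vol A ^ (m - 1) * vol (A + (\<Sum>i\<in>{1..m}. B i)) \<le> (\<Prod>i\<in>{1..m}. vol (A + B i)))
    \<longleftrightarrow> volume_log_submodular" (is "?P \<longleftrightarrow> _")
proof
  assume P: ?P
  show volume_log_submodular unfolding volume_log_submodular_def
  proof (intro ballI)
    fix A B C assume K: "A \<in> \<K>" "B \<in> \<K>" "C \<in> \<K>"
    let ?B = "\<lambda>i::nat. if i = 1 then B else C"
    have "vol A ^ (2 - 1) * vol (A + (\<Sum>i\<in>{1..2}. ?B i)) \<le> (\<Prod>i\<in>{1..2}. vol (A + ?B i))"
      using K by (intro P[rule_format]) auto
    moreover have "{1..2} = {1, 2::nat}" by auto
    ultimately show "vol A * vol (A + B + C) \<le> vol (A + B) * vol (A + C)"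
      by (simp add: add.assoc)
  qed
next
  assume volume_log_submodular
  then show ?P using product_inequality by blast
qed

lemma set_function_submodular_iff:
  "(\<forall>m\<ge>1. \<forall>A\<in>\<K>. \<forall>B\<in>{1..m} \<rightarrow> \<K>.
      submodular_set_fun m (\<lambda>S. log_ext (vol (A + (\<Sum>i\<in>S. B i)))))
    \<longleftrightarrow> volume_log_submodular" (is "?P \<longleftrightarrow> _")
proof
  assume P: ?P
  show volume_log_submodular
    by (rule volume_inequality_of_set_function_submodular, rule P[rule_format]) auto
next
  assume volume_log_submodular
  then show ?P using set_function_submodular by blast
qed

lemma function_submodular_iff:
  "(\<forall>m\<ge>1. \<forall>A\<in>\<K>. \<forall>B\<in>{1..m} \<rightarrow> \<K>.
      submodular_fun m (\<lambda>x. log_ext (vol (A + (\<Sum>i\<in>{1..m}. dilate (x i) (B i))))))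
    \<longleftrightarrow> volume_log_submodular" (is "?P \<longleftrightarrow> _")
proof
  assume P: ?P
  show volume_log_submodular
    by (rule volume_inequality_of_function_submodular, rule P[rule_format]) auto
next
  assume volume_log_submodular
  then show ?P using function_submodular by blast
qed

lemma mixed_volume_inequality_iff:
  "(\<forall>A\<in>\<K>. \<forall>B\<^sub>1\<in>\<K>. \<forall>B\<^sub>2\<in>\<K>.
      vol A * mixed_volume (replicate (CARD('n) - 2) A @ [B\<^sub>1, B\<^sub>2])
        \<le> real CARD('n) / (real CARD('n) - 1) * mixed_volume (replicate (CARD('n) - 1) A @ [B\<^sub>1])
            * mixed_volume (replicate (CARD('n) - 1) A @ [B\<^sub>2]))
    \<longleftrightarrow> volume_log_submodular" (is "?P \<longleftrightarrow> _")
proof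
  assume P: ?P
  show volume_log_submodular
    by (rule volume_inequality_of_mixed_volume_inequality, rule P[rule_format])
next
  assume volume_log_submodular
  then show ?P using mixed_volume_inequality_of_volume_inequality by blast
qed

end

section \<open>Statement 3: compressions of multi-hypergraphs\<close>

text \<open>Each elementary compression is one instance of submodularity, so induction along the
  sequence suffices.\<close>

lemma compression_sum_le:
  assumes F: "submodular_set_fun m F" and A: "multi_hypergraph m \<A>" and AB: "compresses_to \<A> \<B>"
  shows "(\<Sum>T\<in>#restore_discarded \<A> \<B>. F T) \<le> (\<Sum>S\<in>#\<A>. F S)"
proof -
  \<comment> \<open>The size bound belongs to the invariant because
    \<open>size \<A> - size \<B>\<close> is a truncated subtraction.\<close>
  have "multi_hypergraph m \<B> \<and> size \<B> \<le> size \<A> \<and> (\<Sum>T\<in>#restore_discarded \<A> \<B>. F T) \<le> (\<Sum>S\<in>#\<A>. F S)"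
    using AB unfolding compresses_to_def
  proof (induction rule: rtranclp_induct)
    case base
    then show ?case using A by (simp add: restore_discarded_def)
  next
    case (step \<B> \<C>)
    from step.hyps(2) obtain S T where ST: "{#S, T#} \<subseteq># \<B>" "\<not> S \<subseteq> T" "\<not> T \<subseteq> S"
      and C: "\<C> = \<B> - {#S, T#} + (if S \<inter> T = {} then {#S \<union> T#} else {#S \<inter> T, S \<union> T#})"
      unfolding elementary_compression_def by blast
    define R where "R = \<B> - {#S, T#}"
    have B: "\<B> = R + {#S, T#}" unfolding R_def using subset_mset.diff_add[OF ST(1)] by simp
    have sub: "S \<subseteq> {1..m}" "T \<subseteq> {1..m}" using step.IH by (auto simp: multi_hypergraph_def B)
    have "multi_hypergraph m \<C>"
      using step.IH ST(2) sub unfolding C R_def[symmetric] by (auto simp: multi_hypergraph_def B)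
    moreover have "size \<C> \<le> size \<A>"
      using step.IH unfolding C R_def[symmetric] by (auto simp: B)
    \<comment> \<open>Once the discarded empty sets are restored, both forms of the compression
      replace \<open>S, T\<close> by \<open>S \<inter> T, S \<union> T\<close>.\<close>
    moreover have restore: "restore_discarded \<A> \<C> = R + {#S \<inter> T, S \<union> T#} + replicate_mset (size \<A> - size \<B>) {}"
    proof (cases "S \<inter> T = {}")
      case True
      then have "size \<A> - size \<C> = Suc (size \<A> - size \<B>)"
        using step.IH unfolding C R_def[symmetric] by (auto simp: B)
      then show ?thesis using True unfolding restore_discarded_def C R_def[symmetric] by simp
    next
      case False
      then have "size \<C> = size \<B>" unfolding C R_def[symmetric] by (simp add: B)
      then show ?thesis using False unfolding restore_discarded_def C R_def[symmetric] by simp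
    qed
    moreover have "(\<Sum>T\<in>#restore_discarded \<A> \<C>. F T) \<le> (\<Sum>T\<in>#restore_discarded \<A> \<B>. F T)"
    proof -
      let ?r = "\<Sum>X\<in>#R + replicate_mset (size \<A> - size \<B>) {}. F X"
      have "(\<Sum>T\<in>#restore_discarded \<A> \<C>. F T) = ?r + (F (S \<union> T) + F (S \<inter> T))"
        unfolding restore by (simp add: ac_simps)
      also have "\<dots> \<le> ?r + (F S + F T)"
        using F sub unfolding submodular_set_fun_def by (intro add_left_mono) blast
      also have "\<dots> = (\<Sum>T\<in>#restore_discarded \<A> \<B>. F T)"
        unfolding restore_discarded_def by (simp add: B ac_simps)
      finally show ?thesis .
    qed
    ultimately show ?case using step.IH by (meson order_trans)
  qed
  then show ?thesis by blast
qed

text \<open>A nested pair gives equality; a non-nested pair is itself a multi-hypergraph, and its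
  one elementary compression gives the inequality.\<close>

lemma submodular_set_fun_if_compression_sum_le:
  assumes le: "\<And>\<A> \<B>. multi_hypergraph m \<A> \<Longrightarrow> multi_hypergraph m \<B> \<Longrightarrow> compresses_to \<A> \<B> \<Longrightarrow>
      (\<Sum>T\<in>#restore_discarded \<A> \<B>. F T) \<le> (\<Sum>S\<in>#\<A>. F S)"
  shows "submodular_set_fun m F"
  unfolding submodular_set_fun_def
proof (intro allI impI)
  fix S T assume ST: "S \<subseteq> {1..m} \<and> T \<subseteq> {1..m}"
  show "F (S \<union> T) + F (S \<inter> T) \<le> F S + F T"
  proof (cases "S \<subseteq> T \<or> T \<subseteq> S")
    case True
    then show ?thesis by (auto simp: Un_absorb1 Un_absorb2 Int_absorb1 Int_absorb2 add.commute)
  next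
    case False
    let ?B = "if S \<inter> T = {} then {#S \<union> T#} else {#S \<inter> T, S \<union> T#}"
    have "elementary_compression {#S, T#} ?B"
      unfolding elementary_compression_def using False by (intro exI[of _ S] exI[of _ T]) auto
    then have "(\<Sum>X\<in>#restore_discarded {#S, T#} ?B. F X) \<le> (\<Sum>X\<in>#{#S, T#}. F X)"
      using ST False unfolding compresses_to_def
      by (intro le) (auto simp: multi_hypergraph_def compresses_to_def)
    then show ?thesis by (auto simp: restore_discarded_def add.commute split: if_splits)
  qed
qed

theorem theorem3p6:
  fixes \<K> :: "(real ^ 'n) set set"
  assumes dim: "CARD('n) \<ge> 2"
    and bodies: "\<K> \<subseteq> convex_bodies"
    and stable: "stable_under_sums_and_dilation \<K>"
  shows
    "let n = CARD('n);
         P1 = (\<forall>m\<ge>1. \<forall>A\<in>\<K>. \<forall>B\<in>{1..m} \<rightarrow> \<K>.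
                 vol A ^ (m - 1) * vol (A + (\<Sum>i\<in>{1..m}. B i)) \<le> (\<Prod>i\<in>{1..m}. vol (A + B i)));
         P2 = (\<forall>m\<ge>1. \<forall>A\<in>\<K>. \<forall>B\<in>{1..m} \<rightarrow> \<K>.
                 submodular_set_fun m (\<lambda>S. log_ext (vol (A + (\<Sum>i\<in>S. B i)))));
         P3 = (\<forall>m\<ge>1. \<forall>A\<in>\<K>. \<forall>B\<in>{1..m} \<rightarrow> \<K>. \<forall>\<A> \<B>.
                 multi_hypergraph m \<A> \<and> multi_hypergraph m \<B> \<and> compresses_to \<A> \<B> \<longrightarrow>
                 (\<Sum>S\<in>#\<A>. log_ext (vol (A + (\<Sum>i\<in>S. B i))))
                   \<ge> (\<Sum>T\<in>#restore_discarded \<A> \<B>. log_ext (vol (A + (\<Sum>i\<in>T. B i)))));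
         P4 = (\<forall>m\<ge>1. \<forall>A\<in>\<K>. \<forall>B\<in>{1..m} \<rightarrow> \<K>.
                 submodular_fun m (\<lambda>x. log_ext (vol (A + (\<Sum>i\<in>{1..m}. dilate (x i) (B i))))));
         P5 = (\<forall>A\<in>\<K>. \<forall>B\<^sub>1\<in>\<K>. \<forall>B\<^sub>2\<in>\<K>.
                 vol A * mixed_volume (replicate (n - 2) A @ [B\<^sub>1, B\<^sub>2])
                   \<le> real n / (real n - 1) * mixed_volume (replicate (n - 1) A @ [B\<^sub>1])
                                           * mixed_volume (replicate (n - 1) A @ [B\<^sub>2]))
     in (P1 \<longleftrightarrow> P2) \<and> (P2 \<longleftrightarrow> P3) \<and> (P3 \<longleftrightarrow> P4) \<and> (P4 \<longleftrightarrow> P5)"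
proof -
  \<comment> \<open>For each fixed \<open>m\<close> and set function \<open>F\<close> the
    compression inequality is submodularity, which rewrites statement 3 into statement 2.\<close>
  have P3: "(\<forall>\<A> \<B>. multi_hypergraph m \<A> \<and> multi_hypergraph m \<B> \<and> compresses_to \<A> \<B> \<longrightarrow>
      (\<Sum>S\<in>#\<A>. F S) \<ge> (\<Sum>T\<in>#restore_discarded \<A> \<B>. F T)) \<longleftrightarrow> submodular_set_fun m F" for m F
    using compression_sum_le submodular_set_fun_if_compression_sum_le by blast
  note iffs = product_inequality_iff set_function_submodular_iff function_submodular_iff mixed_volume_inequality_iff
  show ?thesis
    unfolding Let_def P3 iffs[OF dim bodies stable] by blast
qed

end
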